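(* Let $[\mathbf{T},\mathbf{o}]$ be a unimodular random rooted ordered Eternal Family Tree such that $\mathbf{T}$ almost surely has a unique succession line. Then there exists a stationary sequence $Y=(Y_n)_{n\in\mathbb{Z}}$ of random variables with values in $\{-1,0,1,2,\dots\}$ such that $[\mathbf{T},\mathbf{o}]$ has the same distribution (as a rooted ordered tree) as $[\mathbb{Z}^R_Y(0),0]$, the connected component of $0$ in the record graph of $Y$, rooted at $0$ with children ordered by the order of $\mathbb{Z}$. In particular such a $Y$ exists whenever $[\mathbf{T},\mathbf{o}]$ is of class $\mathcal{I}/\mathcal{I}$.
   Context: A Family Tree is a directed tree in which every vertex has out-degree at most one (the out-neighbour is the parent $F(u)$); an Eternal Family Tree (EFT) is one where every vertex has out-degree exactly one; all trees are locally finite. An ordered Family Tree has the children of each vertex totally ordered by $<$. The RLS (depth-first) order $\prec$ on vertices: $u\prec v$ if $v=F^k(u)$ for some $k>0$, or if $w=F^m(u)=F^n(v)$ is the first common ancestor (with $m,n\ge1$ minimal) and $F^{m-1}(u)<F^{n-1}(v)$. For a vertex $u$, $b(u)=\max\{v:v\prec u\}$ and $a(u)=\min\{v:v\succ u\}$ when they exist. The succession line through $o$ is $(u_n)_{n\in\mathbb{Z}}$ with $u_0=o$, $u_n=b(u_{n+1})$ for $n<0$ and $u_n=a(u_{n-1})$ for $n>0$ (with $u_n=u_{n+1}$, resp. $u_n=u_{n-1}$, if $b$, resp. $a$, does not exist); its set of vertices $\{u_n\}$ is a succession line of $T$. $T$ has a unique succession line if all these sets coincide, i.e. all vertices lie on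 one succession line. A random rooted network $[\mathbf{G},\mathbf{o}]$ (here marks encode the order) is unimodular if $\mathbb{E}[\sum_{u}h([\mathbf{G},\mathbf{o},u])]=\mathbb{E}[\sum_u h([\mathbf{G},u,\mathbf{o}])]$ for every measurable $h\ge0$ on doubly rooted isomorphism classes. An EFT is of class $\mathcal{I}/\mathcal{I}$ if every foil is infinite, where $u,v$ are in the same foil if $F^n(u)=F^n(v)$ for some $n\ge1$. Record graph: for $y=(y_n)$, $R_y(i)=\inf\{n>i:\sum_{l=i}^{n-1}y_l\ge0\}$ if this set is nonempty, else $i$; edges $i\to R_y(i)$ for $R_y(i)\ne i$; components in the undirected sense. *)

theory Defs
  imports "HOL-Probability.Probability"
begin

text \<open>An ordered Eternal Family Tree on vertex type 'v with vertex set UNIV: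
  F is the parent map, lt orders siblings (children of the same vertex).\<close>

definition ordered_EFT :: "('v \<Rightarrow> 'v) \<Rightarrow> ('v \<Rightarrow> 'v \<Rightarrow> bool) \<Rightarrow> bool" where
  "ordered_EFT F lt \<longleftrightarrow>
     (\<forall>u v. \<exists>m n. (F ^^ m) u = (F ^^ n) v) \<and>
     (\<forall>u k. k > 0 \<longrightarrow> (F ^^ k) u \<noteq> u) \<and>
     (\<forall>v. finite {u. F u = v}) \<and>
     (\<forall>u. \<not> lt u u) \<and>
     (\<forall>u u' u''. F u = F u' \<and> F u' = F u'' \<and> lt u u' \<and> lt u' u'' \<longrightarrow> lt u u'') \<and>
     (\<forall>u u'. F u = F u' \<and> u \<noteq> u' \<longrightarrow> lt u u' \<or> lt u' u)"

definition first_common_anc :: "('v \<Rightarrow> 'v) \<Rightarrow> 'v \<Rightarrow> 'v \<Rightarrow> nat \<Rightarrow> nat \<Rightarrow> bool" where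
  "first_common_anc F u v m n \<longleftrightarrow>
     1 \<le> m \<and> 1 \<le> n \<and> (F ^^ m) u = (F ^^ n) v \<and>
     (\<forall>m' n'. 1 \<le> m' \<and> 1 \<le> n' \<and> (F ^^ m') u = (F ^^ n') v \<longrightarrow> m \<le> m' \<and> n \<le> n')"

definition rls :: "('v \<Rightarrow> 'v) \<Rightarrow> ('v \<Rightarrow> 'v \<Rightarrow> bool) \<Rightarrow> 'v \<Rightarrow> 'v \<Rightarrow> bool" where
  "rls F lt u v \<longleftrightarrow>
     (\<exists>k>0. v = (F ^^ k) u) \<or>
     (\<exists>m n. first_common_anc F u v m n \<and> lt ((F ^^ (m - 1)) u) ((F ^^ (n - 1)) v))"

definition is_b :: "('v \<Rightarrow> 'v) \<Rightarrow> ('v \<Rightarrow> 'v \<Rightarrow> bool) \<Rightarrow> 'v \<Rightarrow> 'v \<Rightarrow> bool" where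
  "is_b F lt u v \<longleftrightarrow> rls F lt v u \<and> (\<forall>v'. rls F lt v' u \<longrightarrow> v' = v \<or> rls F lt v' v)"

definition is_a :: "('v \<Rightarrow> 'v) \<Rightarrow> ('v \<Rightarrow> 'v \<Rightarrow> bool) \<Rightarrow> 'v \<Rightarrow> 'v \<Rightarrow> bool" where
  "is_a F lt u v \<longleftrightarrow> rls F lt u v \<and> (\<forall>v'. rls F lt u v' \<longrightarrow> v' = v \<or> rls F lt v v')"

definition bstep :: "('v \<Rightarrow> 'v) \<Rightarrow> ('v \<Rightarrow> 'v \<Rightarrow> bool) \<Rightarrow> 'v \<Rightarrow> 'v" where
  "bstep F lt u = (if \<exists>v. is_b F lt u v then THE v. is_b F lt u v else u)"

definition astep :: "('v \<Rightarrow> 'v) \<Rightarrow> ('v \<Rightarrow> 'v \<Rightarrow> bool) \<Rightarrow> 'v \<Rightarrow> 'v" where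
  "astep F lt u = (if \<exists>v. is_a F lt u v then THE v. is_a F lt u v else u)"

definition succ_seq :: "('v \<Rightarrow> 'v) \<Rightarrow> ('v \<Rightarrow> 'v \<Rightarrow> bool) \<Rightarrow> 'v \<Rightarrow> int \<Rightarrow> 'v" where
  "succ_seq F lt r n =
     (if n \<ge> 0 then (astep F lt ^^ nat n) r else (bstep F lt ^^ nat (- n)) r)"

definition succ_line :: "('v \<Rightarrow> 'v) \<Rightarrow> ('v \<Rightarrow> 'v \<Rightarrow> bool) \<Rightarrow> 'v \<Rightarrow> 'v set" where
  "succ_line F lt r = range (succ_seq F lt r)"

definition unique_succession_line :: "('v \<Rightarrow> 'v) \<Rightarrow> ('v \<Rightarrow> 'v \<Rightarrow> bool) \<Rightarrow> bool" where
  "unique_succession_line F lt \<longleftrightarrow> (\<forall>r r'. succ_line F lt r = succ_line F lt r')"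

definition foil :: "('v \<Rightarrow> 'v) \<Rightarrow> 'v \<Rightarrow> 'v set" where
  "foil F u = {v. \<exists>n\<ge>1. (F ^^ n) u = (F ^^ n) v}"

definition class_II :: "('v \<Rightarrow> 'v) \<Rightarrow> bool" where
  "class_II F \<longleftrightarrow> (\<forall>u. infinite (foil F u))"

text \<open>A general ordered Family Tree: vertex set V, partial parent map par
  (None = no parent), sibling order lt.  Vertices are addressed relative to
  the root r by (k, w): go up k generations, then descend along child indices w
  (children numbered 0,1,2,... in the order lt).\<close>

definition children :: "'v set \<Rightarrow> ('v \<Rightarrow> 'v option) \<Rightarrow> 'v \<Rightarrow> 'v set" where
  "children V par v = {u \<in> V. par u = Some v}"

definition child_idx :: "'v set \<Rightarrow> ('v \<Rightarrow> 'v option) \<Rightarrow> ('v \<Rightarrow> 'v \<Rightarrow> bool) \<Rightarrow> 'v \<Rightarrow> nat" where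
  "child_idx V par lt u = card {u' \<in> V. par u' = par u \<and> lt u' u}"

definition nth_child :: "'v set \<Rightarrow> ('v \<Rightarrow> 'v option) \<Rightarrow> ('v \<Rightarrow> 'v \<Rightarrow> bool) \<Rightarrow> 'v \<Rightarrow> nat \<Rightarrow> 'v option" where
  "nth_child V par lt v i =
     (if finite (children V par v) \<and> (\<exists>u \<in> children V par v. child_idx V par lt u = i)
      then Some (THE u. u \<in> children V par v \<and> child_idx V par lt u = i) else None)"

primrec desc :: "'v set \<Rightarrow> ('v \<Rightarrow> 'v option) \<Rightarrow> ('v \<Rightarrow> 'v \<Rightarrow> bool) \<Rightarrow> 'v \<Rightarrow> nat list \<Rightarrow> 'v option" where
  "desc V par lt v [] = Some v"
| "desc V par lt v (i # w) = Option.bind (nth_child V par lt v i) (\<lambda>u. desc V par lt u w)"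

definition anc :: "('v \<Rightarrow> 'v option) \<Rightarrow> nat \<Rightarrow> 'v \<Rightarrow> 'v option" where
  "anc par k r = ((\<lambda>x. Option.bind x par) ^^ k) (Some r)"

definition addr :: "'v set \<Rightarrow> ('v \<Rightarrow> 'v option) \<Rightarrow> ('v \<Rightarrow> 'v \<Rightarrow> bool) \<Rightarrow> 'v \<Rightarrow> nat \<times> nat list \<Rightarrow> 'v option" where
  "addr V par lt r kw = Option.bind (anc par (fst kw) r) (\<lambda>a. desc V par lt a (snd kw))"

type_synonym tcode = "(nat \<Rightarrow> nat option) \<times> (nat \<times> nat list \<Rightarrow> enat option)"

text \<open>Code of [T,r]: first component gives, for each k, the index of F^k(r) among
  the children of F^(k+1)(r) (None if F^(k+1)(r) does not exist); second component
  gives, for each address, None if there is no vertex there, else its number of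
  children (\<infinity> if infinite).  Two rooted ordered Family Trees are isomorphic iff
  their codes agree.\<close>
definition tree_code :: "'v set \<Rightarrow> ('v \<Rightarrow> 'v option) \<Rightarrow> ('v \<Rightarrow> 'v \<Rightarrow> bool) \<Rightarrow> 'v \<Rightarrow> tcode" where
  "tree_code V par lt r =
     ((\<lambda>k. case (anc par k r, anc par (Suc k) r) of
             (Some a, Some _) \<Rightarrow> Some (child_idx V par lt a) | _ \<Rightarrow> None),
      (\<lambda>kw. map_option (\<lambda>v. if finite (children V par v) then enat (card (children V par v)) else \<infinity>)
              (addr V par lt r kw)))"

text \<open>Address of u relative to r (with minimal number of upward steps); together
  with the code of (T,r) it encodes the doubly rooted class [T,r,u].\<close>
definition rel_addr :: "'v set \<Rightarrow> ('v \<Rightarrow> 'v option) \<Rightarrow> ('v \<Rightarrow> 'v \<Rightarrow> bool) \<Rightarrow> 'v \<Rightarrow> 'v \<Rightarrow> nat \<times> nat list" where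
  "rel_addr V par lt r u =
     (let k = (LEAST k. \<exists>w. addr V par lt r (k, w) = Some u)
      in (k, THE w. addr V par lt r (k, w) = Some u))"

definition code_space :: "tcode measure" where
  "code_space = (\<Pi>\<^sub>M k\<in>UNIV. count_space UNIV) \<Otimes>\<^sub>M (\<Pi>\<^sub>M kw\<in>UNIV. count_space UNIV)"

definition unimodular_EFT ::
  "'w measure \<Rightarrow> ('w \<Rightarrow> nat \<Rightarrow> nat) \<Rightarrow> ('w \<Rightarrow> nat \<Rightarrow> nat \<Rightarrow> bool) \<Rightarrow> ('w \<Rightarrow> nat) \<Rightarrow> bool" where
  "unimodular_EFT M F lt r \<longleftrightarrow>
     (\<forall>h \<in> borel_measurable (code_space \<Otimes>\<^sub>M count_space UNIV).
        (\<integral>\<^sup>+ \<omega>. (\<integral>\<^sup>+ u. h (tree_code UNIV (Some \<circ> F \<omega>) (lt \<omega>) (r \<omega>),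
                               rel_addr UNIV (Some \<circ> F \<omega>) (lt \<omega>) (r \<omega>) u) \<partial>count_space UNIV) \<partial>M)
      = (\<integral>\<^sup>+ \<omega>. (\<integral>\<^sup>+ u. h (tree_code UNIV (Some \<circ> F \<omega>) (lt \<omega>) u,
                               rel_addr UNIV (Some \<circ> F \<omega>) (lt \<omega>) u (r \<omega>)) \<partial>count_space UNIV) \<partial>M))"

definition rec_R :: "(int \<Rightarrow> int) \<Rightarrow> int \<Rightarrow> int" where
  "rec_R y i = (if \<exists>n>i. (\<Sum>l\<in>{i..<n}. y l) \<ge> 0
                 then Inf {n. n > i \<and> (\<Sum>l\<in>{i..<n}. y l) \<ge> 0} else i)"

definition record_edge :: "(int \<Rightarrow> int) \<Rightarrow> int \<Rightarrow> int \<Rightarrow> bool" where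
  "record_edge y i j \<longleftrightarrow> rec_R y i \<noteq> i \<and> j = rec_R y i"

definition record_comp :: "(int \<Rightarrow> int) \<Rightarrow> int set" where
  "record_comp y = {j. (\<lambda>a b. record_edge y a b \<or> record_edge y b a)\<^sup>*\<^sup>* 0 j}"

definition record_par :: "(int \<Rightarrow> int) \<Rightarrow> int \<Rightarrow> int option" where
  "record_par y i = (if rec_R y i \<noteq> i then Some (rec_R y i) else None)"

definition record_code :: "(int \<Rightarrow> int) \<Rightarrow> tcode" where
  "record_code y = tree_code (record_comp y) (record_par y) (<) 0"

definition seq_space :: "(int \<Rightarrow> int) measure" where
  "seq_space = (\<Pi>\<^sub>M n\<in>UNIV. count_space UNIV)"

end

(* The RLS order of an EFT is a linear order in which every vertex precedes its parent. It is
   order isomorphic to the integers as soon as intervals are finite and there is no minimum. Mass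
   transport excludes a minimum: every vertex sends mass 1 to the minimum. In class I/I it also makes
   intervals finite: if a vertex had descendants in all later generations, such vertices would form
   a single line (they have one such child on average, hence exactly one), and every vertex could
   send mass 1 to the one in its foil, which receives infinite mass.

   With vertices u_n enumerated along the succession line, Y_n = (number of children of u_{n+1}) - 1.
   The sum of Y over [i, n) counts the vertices with parent in (i, n], minus (n - i); since subtrees
   are intervals, it first becomes nonnegative when u_n is the parent of u_i. Stationarity is mass
   transport from each vertex to its predecessor. Because only the tree code is a random
   variable, all of this is carried out on canonical addresses read off from the code. *)

theory Submission
  imports Defs
begin

subsection \<open>The RLS order\<close>

text \<open>\<open>F\<close>, \<open>lt\<close> and \<open>r\<close> may depend on the sample point
  in any way; only the code at the root is measurable. Every event must therefore be an event about
  that code, and a statement about all vertices has to be won from one about the root by a further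
  transport. The transported masses are never shown to be measurable in the sample point: their
  integrals are handled only by monotonicity, almost sure equality and comparison with indicators of
  measurable events.

  Class I/I is not reduced to a unique succession line. Each alternative yields finite intervals,
  and from there on the argument is common.

  Degrees alone recover the tree because children precede parents: read the vertices in RLS order
  with a stack, each vertex removing its children and pushing itself. Each partial sum of degree
  minus one is the drop in stack height. After \<open>u_i\<close> is pushed the height stays
  strictly larger until the parent removes \<open>u_i\<close>, and this is the first time the drop
  is nonnegative.\<close>

lemma funpow_comm: "(f ^^ m) ((f ^^ n) x) = (f ^^ (m + n)) x"
  by (simp add: funpow_add)

lemma funpow_shift: "(f ^^ n) (f x) = (f ^^ Suc n) x"
  by (simp add: funpow_swap1)

locale eft =
  fixes F :: "'v \<Rightarrow> 'v" and lt :: "'v \<Rightarrow> 'v \<Rightarrow> bool"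
  assumes eft: "ordered_EFT F lt"
begin

lemma connected: "\<exists>m n. (F ^^ m) u = (F ^^ n) v"
  using eft unfolding ordered_EFT_def by blast

lemma acyclic: "k > 0 \<Longrightarrow> (F ^^ k) u \<noteq> u"
  using eft unfolding ordered_EFT_def by blast

lemma F_neq: "F u \<noteq> u"
  using acyclic[of 1 u] by simp

lemma finite_children: "finite {u. F u = v}"
  using eft unfolding ordered_EFT_def by blast

lemma lt_irrefl: "\<not> lt u u"
  using eft unfolding ordered_EFT_def by blast

lemma lt_trans: "F u = F v \<Longrightarrow> F v = F w \<Longrightarrow> lt u v \<Longrightarrow> lt v w \<Longrightarrow> lt u w"
  using eft unfolding ordered_EFT_def by blast

lemma lt_total: "F u = F v \<Longrightarrow> u \<noteq> v \<Longrightarrow> lt u v \<or> lt v u"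
  using eft unfolding ordered_EFT_def by blast

lemma funpow_F_inj: assumes "(F ^^ m) u = (F ^^ n) u" shows "m = n"
proof -
  have *: "a = b" if "a \<le> b" "(F ^^ a) u = (F ^^ b) u" for a b
  proof (rule ccontr)
    assume "a \<noteq> b"
    then have "b - a > 0" using that by simp
    moreover have "(F ^^ (b - a)) ((F ^^ a) u) = (F ^^ a) u"
      by (subst funpow_comm) (use that in simp)
    ultimately show False using acyclic by blast
  qed
  show ?thesis using *[of m n] *[of n m] assms by (cases "m \<le> n") auto
qed

lemma funpow_F_shift: "(F ^^ m) u = (F ^^ n) v \<Longrightarrow> (F ^^ (m + t)) u = (F ^^ (n + t)) v"
  by (metis add.commute funpow_comm)

text \<open>By acyclicity the number of steps to a given ancestor is unique, so two ancestor lines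
  advance in lockstep once they have met.\<close>

lemma common_anc_diff:
  assumes "(F ^^ m) u = (F ^^ n) v" "(F ^^ m') u = (F ^^ n') v" "m \<le> m'"
  shows "n' = n + (m' - m)"
proof -
  have "(F ^^ m') u = (F ^^ (n + (m' - m))) v"
    using funpow_F_shift[OF assms(1), of "m' - m"] assms(3) by simp
  then have "(F ^^ n') v = (F ^^ (n + (m' - m))) v" using assms(2) by simp
  then show ?thesis by (rule funpow_F_inj)
qed

text \<open>Minimality of the common ancestor comes for free: an earlier meeting would, in lockstep,
  identify the two siblings compared by \<open>lt\<close>, against irreflexivity. Later arguments
  can thus use any pair of comparable siblings above \<open>u\<close> and \<open>v\<close>.\<close>

lemma rls_iff:
  "rls F lt u v \<longleftrightarrow> (\<exists>k>0. v = (F ^^ k) u) \<or>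
     (\<exists>m n. (F ^^ Suc m) u = (F ^^ Suc n) v \<and> lt ((F ^^ m) u) ((F ^^ n) v))"
    (is "_ \<longleftrightarrow> ?A \<or> ?B")
proof
  assume "rls F lt u v"
  then consider ?A | m n where "first_common_anc F u v m n" "lt ((F ^^ (m - 1)) u) ((F ^^ (n - 1)) v)"
    unfolding rls_def by blast
  then show "?A \<or> ?B"
  proof cases
    case 2
    then have "(F ^^ Suc (m-1)) u = (F ^^ Suc (n-1)) v"
      unfolding first_common_anc_def by (metis One_nat_def Suc_pred less_eq_Suc_le)
    then show ?thesis using 2 by blast
  qed blast
next
  assume "?A \<or> ?B"
  then show "rls F lt u v"
  proof
    assume ?B
    then obtain m n where mn: "(F ^^ Suc m) u = (F ^^ Suc n) v" "lt ((F ^^ m) u) ((F ^^ n) v)" by blast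
    have "Suc m \<le> m' \<and> Suc n \<le> n'" if "(F ^^ m') u = (F ^^ n') v" for m' n'
    proof (cases "Suc m \<le> m'")
      case True
      then show ?thesis using common_anc_diff[OF mn(1) that] by simp
    next
      case False
      then have "m' \<le> Suc m" by simp
      from common_anc_diff[OF that mn(1) this] have "Suc n = n' + (Suc m - m')" .
      then have "n = n' + (m - m')" "m = m' + (m - m')" using False by auto
      then have "(F ^^ m) u = (F ^^ n) v" using funpow_F_shift[OF that, of "m - m'"] by simp
      then show ?thesis using mn(2) lt_irrefl by simp
    qed
    then have "first_common_anc F u v (Suc m) (Suc n)"
      unfolding first_common_anc_def using mn(1) by force
    then show ?thesis unfolding rls_def using mn(2) by (metis diff_Suc_1)
  qed (simp add: rls_def)
qed

lemma rls_ancI: "k > 0 \<Longrightarrow> rls F lt u ((F ^^ k) u)"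
  unfolding rls_def by blast

lemma rls_F: "rls F lt u (F u)"
  using rls_ancI[of 1 u] by simp

lemma rls_ltI: "(F ^^ Suc m) u = (F ^^ Suc n) v \<Longrightarrow> lt ((F ^^ m) u) ((F ^^ n) v) \<Longrightarrow> rls F lt u v"
  unfolding rls_iff by blast

lemma rls_irrefl: "\<not> rls F lt u u"
proof
  assume "rls F lt u u"
  then consider k where "k > 0" "u = (F ^^ k) u"
    | m n where "(F ^^ Suc m) u = (F ^^ Suc n) u" "lt ((F ^^ m) u) ((F ^^ n) u)"
    unfolding rls_iff by blast
  then show False
  proof cases
    case 1 then show ?thesis using acyclic by metis
  next
    case 2 then show ?thesis using funpow_F_inj[OF 2(1)] lt_irrefl by auto
  qed
qed

lemma rls_cases [consumes 1, case_names anc lt]: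
  assumes "rls F lt u v"
  obtains k where "k > 0" "v = (F ^^ k) u"
  | m n where "(F ^^ Suc m) u = (F ^^ Suc n) v" "lt ((F ^^ m) u) ((F ^^ n) v)"
  using assms unfolding rls_iff by blast

text \<open>When both relations come from siblings, the two branchings sit at levels
  \<open>n\<close> and \<open>m'\<close> on the line of \<open>v\<close>. The higher one also
  separates \<open>u\<close> from \<open>w\<close>; at equal level, transitivity among siblings
  decides.\<close>

lemma rls_trans: assumes "rls F lt u v" "rls F lt v w" shows "rls F lt u w"
proof -
  consider (AA) k l where "k > 0" "v = (F ^^ k) u" "l > 0" "w = (F ^^ l) v"
    | (AL) k m n where "k > 0" "v = (F ^^ k) u" "(F ^^ Suc m) v = (F ^^ Suc n) w" "lt ((F ^^ m) v) ((F ^^ n) w)"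
    | (LA) k m n where "(F ^^ Suc m) u = (F ^^ Suc n) v" "lt ((F ^^ m) u) ((F ^^ n) v)" "k > 0" "w = (F ^^ k) v"
    | (LL) m n m' n' where "(F ^^ Suc m) u = (F ^^ Suc n) v" "lt ((F ^^ m) u) ((F ^^ n) v)"
        "(F ^^ Suc m') v = (F ^^ Suc n') w" "lt ((F ^^ m') v) ((F ^^ n') w)"
    using assms(1)
  proof (cases rule: rls_cases)
    case (anc k)
    from assms(2) show ?thesis by (cases rule: rls_cases) (rule AA AL; (fact | use anc in simp))+
  next
    case (lt m n)
    from assms(2) show ?thesis
      by (cases rule: rls_cases) (rule LA[OF lt] LL[OF lt]; assumption)+
  qed
  then show ?thesis
  proof cases
    case AA
    then show ?thesis using rls_ancI[of "l + k" u] by (simp add: funpow_comm)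
  next
    case AL
    then have "(F ^^ Suc (m + k)) u = (F ^^ Suc n) w" "lt ((F ^^ (m + k)) u) ((F ^^ n) w)"
      by (simp_all add: funpow_comm)
    then show ?thesis by (rule rls_ltI)
  next
    case LA
    show ?thesis
    proof (cases "k \<le> n")
      case True
      have "(F ^^ n) v = (F ^^ (n - k)) w" "(F ^^ Suc n) v = (F ^^ Suc (n - k)) w"
        using LA True by (simp_all add: funpow_comm)
      then show ?thesis using LA rls_ltI by metis
    next
      case False
      then have "w = (F ^^ (k - Suc n)) ((F ^^ Suc n) v)"
        using LA(4) by (simp only: funpow_comm) simp
      also have "\<dots> = (F ^^ (k - Suc n + Suc m)) u"
        by (simp only: LA(1)[symmetric] funpow_comm)
      finally show ?thesis using rls_ancI[of "k - Suc n + Suc m" u] by simp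
    qed
  next
    case LL
    consider "n < m'" | "n = m'" | "m' < n" by linarith
    then show ?thesis
    proof cases
      case 1
      have "(F ^^ m') v = (F ^^ (m' - Suc n)) ((F ^^ Suc n) v)"
        using 1 by (simp only: funpow_comm) simp
      also have "\<dots> = (F ^^ (m' - Suc n + Suc m)) u"
        by (simp only: LL(1)[symmetric] funpow_comm)
      finally have e: "(F ^^ m') v = (F ^^ (m' - Suc n + Suc m)) u" .
      show ?thesis
        by (rule rls_ltI[of "m' - Suc n + Suc m" u n' w])
           (use e LL(3,4) in \<open>simp_all only: funpow.simps o_def\<close>)
    next
      case 2
      then have "lt ((F ^^ m) u) ((F ^^ n') w)"
        using LL lt_trans[of "(F ^^ m) u" "(F ^^ n) v" "(F ^^ n') w"] by simp
      then show ?thesis using LL 2 rls_ltI by metis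
    next
      case 3
      have "(F ^^ n) v = (F ^^ (n - Suc m')) ((F ^^ Suc m') v)"
        using 3 by (simp only: funpow_comm) simp
      also have "\<dots> = (F ^^ (n - Suc m' + Suc n')) w"
        by (simp only: LL(3) funpow_comm)
      finally have e: "(F ^^ n) v = (F ^^ (n - Suc m' + Suc n')) w" .
      show ?thesis
        by (rule rls_ltI[of m u "n - Suc m' + Suc n'" w])
           (use e LL(1,2) in \<open>simp_all only: funpow.simps o_def\<close>)
    qed
  qed
qed

lemma rls_asym: "rls F lt u v \<Longrightarrow> \<not> rls F lt v u"
  using rls_trans rls_irrefl by blast

lemma common_anc_cases:
  obtains (desc) n where "v = (F ^^ n) u"
  | (anc) n where "u = (F ^^ n) v"
  | (sib) m n where "(F ^^ Suc m) u = (F ^^ Suc n) v" "(F ^^ m) u \<noteq> (F ^^ n) v"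
proof -
  define m where "m = (LEAST m. \<exists>n. (F ^^ m) u = (F ^^ n) v)"
  have "\<exists>n. (F ^^ m) u = (F ^^ n) v"
    unfolding m_def using connected[of u v] by (rule LeastI_ex)
  then obtain n where n: "(F ^^ m) u = (F ^^ n) v" by blast
  have least: "(F ^^ m') u \<noteq> (F ^^ n') v" if "m' < m" for m' n'
    using not_less_Least[of m' "\<lambda>m. \<exists>n. (F ^^ m) u = (F ^^ n) v"] that unfolding m_def by blast
  show thesis
  proof (cases m)
    case 0
    then show ?thesis using n anc by simp
  next
    case (Suc m1)
    show ?thesis
    proof (cases n)
      case 0
      then show ?thesis using n desc[of m] by simp
    next
      case (Suc n1)
      then show ?thesis using n sib least[of m1 n1] \<open>m = Suc m1\<close> by blast
    qed
  qed
qed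

lemma rls_total: "u = v \<or> rls F lt u v \<or> rls F lt v u"
proof (cases rule: common_anc_cases[of v u])
  case (desc n)
  then show ?thesis by (cases "n = 0") (auto intro: rls_ancI)
next
  case (anc n)
  then show ?thesis by (cases "n = 0") (auto intro: rls_ancI)
next
  case (sib m n)
  then show ?thesis
    using lt_total[of "(F ^^ m) u" "(F ^^ n) v"] rls_ltI[of m u n v] rls_ltI[of n v m u] by auto
qed

text \<open>Between \<open>u\<close> and its parent there are only later siblings of
  \<open>u\<close> and their descendants. For positions on the integers this is the non-crossing
  condition \<open>nest\<close> of \<open>rec_R_parent\<close>.\<close>

lemma rls_nesting:
  assumes "rls F lt u w" "rls F lt w (F u)"
  shows "F w = F u \<or> rls F lt (F w) (F u)"
proof -
  have *: ?thesis if "F u = (F ^^ n) w" for n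
  proof -
    have "n \<noteq> 0" using that assms(2) rls_irrefl[of w] by (metis funpow_0)
    then obtain k where "n = Suc k" by (cases n) auto
    then have "F u = (F ^^ k) (F w)" using that by (simp add: funpow_shift)
    then show ?thesis by (cases "k = 0") (auto intro: rls_ancI)
  qed
  from assms(1) consider k where "k > 0" "w = (F ^^ k) u"
    | m n where "(F ^^ Suc m) u = (F ^^ Suc n) w" "lt ((F ^^ m) u) ((F ^^ n) w)"
    unfolding rls_iff by blast
  then show ?thesis
  proof cases
    case 1
    then obtain j where "k = Suc j" by (cases k) auto
    then have "w = (F ^^ j) (F u)" using 1 by (simp add: funpow_shift)
    then have "w = F u \<or> rls F lt (F u) w" by (cases "j = 0") (auto intro: rls_ancI)
    then show ?thesis using assms(2) rls_asym rls_irrefl by blast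
  next
    case 2
    show ?thesis
    proof (cases m)
      case 0
      then show ?thesis using *[of "Suc n"] 2(1) by simp
    next
      case (Suc j)
      then have "(F ^^ Suc j) (F u) = (F ^^ Suc n) w" "lt ((F ^^ j) (F u)) ((F ^^ n) w)"
        using 2 by (simp_all only: funpow_shift)
      then show ?thesis using assms(2) rls_asym rls_ltI by blast
    qed
  qed
qed

text \<open>A vertex after \<open>u\<close> and outside the subtree of the common ancestor is either
  a strict ancestor of that ancestor or branches off from its line upwards. Either way it is also
  after \<open>v\<close>.\<close>

lemma between_descendant:
  assumes "rls F lt u w" "rls F lt w v" "(F ^^ n) u = (F ^^ m) v"
  shows "\<exists>j. (F ^^ j) w = (F ^^ n) u"
  using assms(1)
proof (cases rule: rls_cases)
  case (anc k)
  show ?thesis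
  proof (cases "k \<le> n")
    case True
    then have "(F ^^ (n - k)) w = (F ^^ n) u" using anc by (simp add: funpow_comm)
    then show ?thesis by blast
  next
    case False
    then have "w = (F ^^ (k - n)) ((F ^^ n) u)" using anc by (simp add: funpow_comm)
    then have "w = (F ^^ (k - n + m)) v" using assms(3) by (simp add: funpow_comm)
    then have "rls F lt v w" using rls_ancI[of "k - n + m" v] False by simp
    then show ?thesis using assms(2) rls_asym by blast
  qed
next
  case (lt a b)
  show ?thesis
  proof (cases "a < n")
    case True
    then have "(F ^^ n) u = (F ^^ (n - Suc a)) ((F ^^ Suc a) u)"
      by (simp only: funpow_comm) simp
    then have "(F ^^ n) u = (F ^^ (n - Suc a + Suc b)) w"
      by (simp only: lt(1) funpow_comm)
    then show ?thesis by metis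
  next
    case False
    then have "(F ^^ a) u = (F ^^ (a - n)) ((F ^^ n) u)"
      by (simp add: funpow_comm)
    then have e: "(F ^^ a) u = (F ^^ (a - n + m)) v"
      using assms(3) by (simp add: funpow_comm)
    have "rls F lt v w"
      by (rule rls_ltI[of "a - n + m" v b w]) (use e lt in \<open>simp_all only: funpow.simps o_def\<close>)
    then show ?thesis using assms(2) rls_asym by blast
  qed
qed

section \<open>Vertices with descendants in every generation\<close>

text \<open>By local finiteness this says that \<open>u\<close> has infinitely many descendants.\<close>

definition deep :: "'v \<Rightarrow> bool" where
  "deep u \<longleftrightarrow> (\<forall>n. \<exists>b. (F ^^ n) b = u)"

lemma deep_F: assumes "deep u" shows "deep (F u)"
  unfolding deep_def
proof
  fix n
  show "\<exists>b. (F ^^ n) b = F u"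
  proof (cases n)
    case 0 then show ?thesis by simp
  next
    case (Suc m)
    obtain b where "(F ^^ m) b = u" using assms unfolding deep_def by blast
    then show ?thesis using Suc by (intro exI[of _ b]) simp
  qed
qed

text \<open>The inductive step of Koenig's lemma: if every child had only boundedly many generations
  below it, the maximum over the finitely many children would bound those below
  \<open>u\<close>.\<close>

lemma deep_child: assumes "deep u" shows "\<exists>v. F v = u \<and> deep v"
proof (rule ccontr)
  assume "\<not> ?thesis"
  then have "\<forall>v\<in>{v. F v = u}. \<exists>n. \<forall>b. (F ^^ n) b \<noteq> v"
    unfolding deep_def by blast
  then have "\<exists>N. \<forall>v\<in>{v. F v = u}. \<forall>b. (F ^^ N v) b \<noteq> v" by (rule bchoice)
  then obtain N where N: "\<And>v b. F v = u \<Longrightarrow> (F ^^ N v) b \<noteq> v" by blast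
  define K where "K = Max (insert 0 (N ` {v. F v = u}))"
  have K: "N v \<le> K" if "F v = u" for v
    unfolding K_def using that finite_children by (intro Max_ge) auto
  obtain b where b: "(F ^^ Suc K) b = u" using assms unfolding deep_def by blast
  define v where "v = (F ^^ K) b"
  have "F v = u" using b v_def by simp
  moreover have "(F ^^ N v) ((F ^^ (K - N v)) b) = v"
    using K[OF \<open>F v = u\<close>] by (simp add: v_def funpow_comm)
  ultimately show False using N by blast
qed

lemma finite_level: "finite {b. (F ^^ n) b = u}"
proof (induction n arbitrary: u)
  case (Suc n)
  have "{b. (F ^^ Suc n) b = u} = (\<Union>v\<in>{v. F v = u}. {b. (F ^^ n) b = v})" by auto
  then show ?case using finite_children Suc.IH by simp
qed simp

lemma finite_descendants: assumes "\<not> deep u" shows "finite {b. \<exists>n. (F ^^ n) b = u}"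
proof -
  obtain n where n: "\<And>b. (F ^^ n) b \<noteq> u" using assms unfolding deep_def by blast
  have "m < n" if "(F ^^ m) b = u" for m b
  proof (rule ccontr)
    assume "\<not> m < n"
    then have "(F ^^ n) ((F ^^ (m - n)) b) = u" using that by (simp add: funpow_comm)
    then show False using n by blast
  qed
  then have "{b. \<exists>n. (F ^^ n) b = u} \<subseteq> (\<Union>m<n. {b. (F ^^ m) b = u})" by auto
  then show ?thesis by (rule finite_subset) (simp add: finite_level)
qed

lemma finite_interval:
  assumes "\<And>u. \<not> deep u"
  shows "finite {w. rls F lt u w \<and> rls F lt w v}"
proof -
  obtain m n where mn: "(F ^^ n) u = (F ^^ m) v" using connected by metis
  have "{w. rls F lt u w \<and> rls F lt w v} \<subseteq> {b. \<exists>j. (F ^^ j) b = (F ^^ n) u}"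
    using between_descendant[OF _ _ mn] by blast
  then show ?thesis using finite_descendants[OF assms] finite_subset by blast
qed

text \<open>Deepness passes to parents, so both lines can be climbed until just before they
  merge.\<close>

lemma same_level_deep_siblings:
  assumes "(F ^^ n) u = (F ^^ n) v" "deep u" "deep v" "u \<noteq> v"
  shows "\<exists>a b. a \<noteq> b \<and> F a = F b \<and> deep a \<and> deep b"
  using assms
proof (induction n arbitrary: u v)
  case (Suc n)
  show ?case
  proof (cases "F u = F v")
    case False
    then show ?thesis using Suc.IH[of "F u" "F v"] Suc.prems deep_F by (simp add: funpow_shift)
  qed (use Suc.prems in blast)
qed simp

text \<open>Used in contrapositive form: where no two siblings are deep, a foil has at most one deep
  vertex and can send its mass there.\<close>

lemma foil_deep_unique:
  assumes "u \<in> foil F x" "v \<in> foil F x" "deep u" "deep v" "u \<noteq> v"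
  shows "\<exists>a b. a \<noteq> b \<and> F a = F b \<and> deep a \<and> deep b"
proof -
  obtain m n where mn: "(F ^^ m) x = (F ^^ m) u" "(F ^^ n) x = (F ^^ n) v"
    using assms unfolding foil_def by auto
  then have "(F ^^ (m + n)) u = (F ^^ (m + n)) v"
    using funpow_F_shift[OF mn(1), of n] funpow_F_shift[OF mn(2), of m] by (simp add: add.commute)
  then show ?thesis using same_level_deep_siblings assms by blast
qed

end

subsection \<open>Canonical addresses\<close>

text \<open>An address \<open>(k, w)\<close> is canonical if \<open>k\<close> is minimal, that is, if \<open>w\<close> does not begin by
  descending into the subtree just left. On canonical addresses the parent map \<open>up\<close> does not depend
  on the code, and \<open>rel_addr\<close> is an isomorphism from the tree onto \<open>code_verts\<close>.\<close>

type_synonym tree_addr = "nat \<times> nat list"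

definition up :: "tree_addr \<Rightarrow> tree_addr" where
  "up a = (if snd a = [] then (Suc (fst a), []) else (fst a, butlast (snd a)))"

text \<open>The address of an ancestor of the root contains no descent, so its sibling index is
  taken from the first component of the code. For codes of an EFT that entry is never
  \<open>None\<close>.\<close>

definition idx :: "tcode \<Rightarrow> tree_addr \<Rightarrow> nat" where
  "idx c a = (if snd a = [] then the (fst c (fst a)) else last (snd a))"

text \<open>Non-siblings are compared too, with no meaning; \<open>rls\<close> consults the order
  only just below a first common ancestor.\<close>

definition code_lt :: "tcode \<Rightarrow> tree_addr \<Rightarrow> tree_addr \<Rightarrow> bool" where
  "code_lt c a b \<longleftrightarrow> idx c a < idx c b"

definition code_verts :: "tcode \<Rightarrow> tree_addr set" where
  "code_verts c = {a. snd c a \<noteq> None \<and>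
     (snd a = [] \<or> fst a = 0 \<or> fst c (fst a - 1) \<noteq> Some (hd (snd a)))}"

context eft
begin

abbreviation cidx :: "'v \<Rightarrow> nat" where
  "cidx \<equiv> child_idx UNIV (Some \<circ> F) lt"

abbreviation code :: "'v \<Rightarrow> tcode" where
  "code \<equiv> tree_code UNIV (Some \<circ> F) lt"

abbreviation rel :: "'v \<Rightarrow> 'v \<Rightarrow> tree_addr" where
  "rel \<equiv> rel_addr UNIV (Some \<circ> F) lt"

section \<open>Codes and addresses evaluated on an Eternal Family Tree\<close>

lemma anc_eq: "anc (Some \<circ> F) k r = Some ((F ^^ k) r)"
  by (induction k) (auto simp: anc_def)

lemma children_eq: "children UNIV (Some \<circ> F) v = {u. F u = v}"
  by (auto simp: children_def)

lemma cidx_eq: "cidx u = card {u'. F u' = F u \<and> lt u' u}"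
  by (simp add: child_idx_def)

lemma cidx_less: assumes "F u = F v" "lt u v" shows "cidx u < cidx v"
  unfolding cidx_eq
proof (rule psubset_card_mono)
  show "finite {u'. F u' = F v \<and> lt u' v}"
    by (rule finite_subset[OF _ finite_children[of "F v"]]) auto
  have "{u'. F u' = F u \<and> lt u' u} \<subseteq> {u'. F u' = F v \<and> lt u' v}"
    using assms lt_trans by (metis (mono_tags, lifting) Collect_mono)
  moreover have "u \<in> {u'. F u' = F v \<and> lt u' v} - {u'. F u' = F u \<and> lt u' u}"
    using assms lt_irrefl by simp
  ultimately show "{u'. F u' = F u \<and> lt u' u} \<subset> {u'. F u' = F v \<and> lt u' v}" by blast
qed

lemma lt_iff_cidx: "F u = F v \<Longrightarrow> lt u v \<longleftrightarrow> cidx u < cidx v"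
  using cidx_less[of u v] cidx_less[of v u] lt_total[of u v] by (metis less_asym less_irrefl)

lemma cidx_inj: "F u = F v \<Longrightarrow> cidx u = cidx v \<Longrightarrow> u = v"
  using cidx_less[of u v] cidx_less[of v u] lt_total[of u v] by force

lemma nth_child_eq: "nth_child UNIV (Some \<circ> F) lt v i = Some u \<longleftrightarrow> F u = v \<and> cidx u = i"
proof -
  have *: "(THE u. F u = v \<and> cidx u = i) = w" if "F w = v" "cidx w = i" for w
    using that cidx_inj by (intro the_equality) auto
  show ?thesis
    unfolding nth_child_def children_eq using finite_children * by auto
qed

lemma desc_append:
  "desc V par l v (w @ w') = Option.bind (desc V par l v w) (\<lambda>u. desc V par l u w')"
  by (induction w arbitrary: v) (auto simp: Option.bind_assoc)

primrec path :: "nat \<Rightarrow> 'v \<Rightarrow> nat list" where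
  "path 0 u = []"
| "path (Suc n) u = path n (F u) @ [cidx u]"

lemma length_path [simp]: "length (path n u) = n"
  by (induction n arbitrary: u) auto

text \<open>\<open>path\<close> grows from the bottom, whereas canonicity of an address is a
  condition on the top entry.\<close>

lemma path_Suc_hd: "path (Suc n) u = cidx ((F ^^ n) u) # path n u"
proof (induction n arbitrary: u)
  case (Suc n)
  have "path (Suc (Suc n)) u = path (Suc n) (F u) @ [cidx u]" by (rule path.simps(2))
  also have "\<dots> = cidx ((F ^^ n) (F u)) # path (Suc n) u" by (subst Suc.IH) simp
  finally show ?case by (simp only: funpow_shift)
qed simp

lemma desc_eq:
  "desc UNIV (Some \<circ> F) lt a w = Some u \<longleftrightarrow> (F ^^ length w) u = a \<and> w = path (length w) u"
proof (induction w arbitrary: u rule: rev_induct)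
  case (snoc i w)
  have "desc UNIV (Some \<circ> F) lt a (w @ [i]) = Some u \<longleftrightarrow>
    (\<exists>v. desc UNIV (Some \<circ> F) lt a w = Some v \<and> nth_child UNIV (Some \<circ> F) lt v i = Some u)"
    by (auto simp: desc_append Option.bind_eq_Some_conv)
  also have "\<dots> \<longleftrightarrow> desc UNIV (Some \<circ> F) lt a w = Some (F u) \<and> cidx u = i"
    by (auto simp: nth_child_eq)
  also have "\<dots> \<longleftrightarrow> (F ^^ length (w @ [i])) u = a \<and> w @ [i] = path (length (w @ [i])) u"
    by (auto simp: snoc funpow_shift)
  finally show ?case .
qed auto

lemma addr_eq:
  "addr UNIV (Some \<circ> F) lt x (k, w) = Some u \<longleftrightarrow> (F ^^ length w) u = (F ^^ k) x \<and> w = path (length w) u"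
  by (simp add: addr_def anc_eq desc_eq)

text \<open>Only the ascent has to be minimal: once \<open>k\<close> is fixed, acyclicity fixes the
  length of the descent and with it the word.\<close>

lemma rel_eqI:
  assumes "(F ^^ k) x = (F ^^ n) u" "\<And>k' n'. (F ^^ k') x = (F ^^ n') u \<Longrightarrow> k \<le> k'"
  shows "rel x u = (k, path n u)"
proof -
  have ex: "addr UNIV (Some \<circ> F) lt x (k, path n u) = Some u"
    using assms(1) by (simp add: addr_eq)
  have k: "(LEAST k. \<exists>w. addr UNIV (Some \<circ> F) lt x (k, w) = Some u) = k"
  proof (rule Least_equality)
    fix k' assume "\<exists>w. addr UNIV (Some \<circ> F) lt x (k', w) = Some u"
    then show "k \<le> k'" using assms(2) by (metis addr_eq)
  qed (use ex in blast)
  have "(THE w. addr UNIV (Some \<circ> F) lt x (k, w) = Some u) = path n u"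
  proof (rule the_equality)
    show "addr UNIV (Some \<circ> F) lt x (k, path n u) = Some u" by (fact ex)
    fix w assume "addr UNIV (Some \<circ> F) lt x (k, w) = Some u"
    then have "(F ^^ length w) u = (F ^^ n) u" "w = path (length w) u"
      using assms(1) by (auto simp: addr_eq)
    then show "w = path n u" using funpow_F_inj by metis
  qed
  then show ?thesis unfolding rel_addr_def Let_def k by simp
qed

lemma rel_obtain:
  obtains k n where "rel x u = (k, path n u)" "(F ^^ k) x = (F ^^ n) u"
    "\<And>k' n'. (F ^^ k') x = (F ^^ n') u \<Longrightarrow> k \<le> k'"
proof -
  define k where "k = (LEAST k. \<exists>n. (F ^^ k) x = (F ^^ n) u)"
  have "\<exists>n. (F ^^ k) x = (F ^^ n) u"
    unfolding k_def using connected[of x u] by (rule LeastI_ex)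
  then obtain n where n: "(F ^^ k) x = (F ^^ n) u" by blast
  have least: "k \<le> k'" if "(F ^^ k') x = (F ^^ n') u" for k' n'
    unfolding k_def by (rule Least_le) (use that in blast)
  show thesis by (rule that[OF rel_eqI[OF n least] n least])
qed

lemma addr_rel: "addr UNIV (Some \<circ> F) lt x (rel x u) = Some u"
  by (cases rule: rel_obtain[of x u]) (simp add: addr_eq)

lemma rel_inj: "rel x u = rel x v \<longleftrightarrow> u = v"
  by (metis addr_rel option.inject)

lemma rel_self: "rel x x = (0, [])"
  using rel_eqI[of 0 x 0 x] by simp

text \<open>If \<open>u\<close> is an ancestor of \<open>x\<close>, acyclicity forces exactly one
  more upward step. Otherwise a meeting of \<open>x\<close> with \<open>F u\<close> is also a
  meeting with \<open>u\<close>, so the minimal ascent is unchanged and only the last descent is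
  dropped.\<close>

lemma rel_F: "rel x (F u) = up (rel x u)"
proof (cases rule: rel_obtain[of x u])
  case (1 k n)
  show ?thesis
  proof (cases n)
    case 0
    have "rel x (F u) = (Suc k, path 0 (F u))"
    proof (rule rel_eqI)
      show "(F ^^ Suc k) x = (F ^^ 0) (F u)" using 1 0 by simp
      fix k' n' assume "(F ^^ k') x = (F ^^ n') (F u)"
      also have "\<dots> = (F ^^ Suc n') ((F ^^ k) x)" using 1 0 by (simp add: funpow_shift)
      finally have "(F ^^ k') x = (F ^^ (Suc n' + k)) x" by (simp only: funpow_comm)
      then show "Suc k \<le> k'" using funpow_F_inj by fastforce
    qed
    then show ?thesis using 1 0 by (simp add: up_def)
  next
    case (Suc m)
    have "rel x (F u) = (k, path m (F u))"
    proof (rule rel_eqI)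
      show "(F ^^ k) x = (F ^^ m) (F u)" using 1 Suc by (simp add: funpow_shift)
      fix k' n' assume "(F ^^ k') x = (F ^^ n') (F u)"
      then show "k \<le> k'" using 1(3) by (metis funpow_shift)
    qed
    then show ?thesis using 1 Suc by (simp add: up_def)
  qed
qed

lemma rel_funpow: "rel x ((F ^^ n) u) = (up ^^ n) (rel x u)"
proof (induction n)
  case (Suc n)
  have "rel x ((F ^^ Suc n) u) = rel x (F ((F ^^ n) u))" by simp
  also have "\<dots> = up (rel x ((F ^^ n) u))" by (rule rel_F)
  also have "\<dots> = (up ^^ Suc n) (rel x u)" by (subst Suc.IH) simp
  finally show ?case .
qed simp

lemma fst_code: "fst (code x) k = Some (cidx ((F ^^ k) x))"
  by (simp add: tree_code_def anc_eq)

lemma snd_code: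
  "snd (code x) a = map_option (\<lambda>v. enat (card {u. F u = v})) (addr UNIV (Some \<circ> F) lt x a)"
  by (simp add: tree_code_def children_eq finite_children)

lemma snd_code_rel: "snd (code x) (rel x u) = Some (enat (card {v. F v = u}))"
  by (simp add: snd_code addr_rel)

lemma idx_rel: "idx (code x) (rel x u) = cidx u"
proof (cases rule: rel_obtain[of x u])
  case (1 k n)
  then show ?thesis by (cases n) (auto simp: idx_def fst_code)
qed

text \<open>Sibling indices are injective, so a word starting with the index of the child just left
  would show that the two lines had already met one step lower. Conversely, by lockstep, a
  non-minimal ascent produces such a word.\<close>

lemma range_rel: "range (rel x) = code_verts (code x)"
proof (intro set_eqI iffI)
  fix a assume "a \<in> range (rel x)"
  then obtain u where u: "a = rel x u" by blast
  show "a \<in> code_verts (code x)"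
  proof (cases rule: rel_obtain[of x u])
    case (1 k n)
    have "fst (code x) (k - 1) \<noteq> Some (hd (path n u))" if "n \<noteq> 0" "k \<noteq> 0"
    proof
      assume e: "fst (code x) (k - 1) = Some (hd (path n u))"
      define m j where "m = n - 1" and "j = k - 1"
      then have mj: "n = Suc m" "k = Suc j" using that by auto
      have "cidx ((F ^^ j) x) = cidx ((F ^^ m) u)"
        using e mj by (simp add: fst_code path_Suc_hd del: path.simps)
      moreover have "F ((F ^^ j) x) = F ((F ^^ m) u)" using 1(2) mj by simp
      ultimately have "(F ^^ j) x = (F ^^ m) u" by (metis cidx_inj)
      then have "k \<le> j" by (rule 1(3))
      then show False using mj by simp
    qed
    moreover have "path n u \<noteq> [] \<Longrightarrow> n \<noteq> 0" by (cases n) auto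
    ultimately show ?thesis
      using 1(1) snd_code_rel[of x u] u unfolding code_verts_def by auto
  qed
next
  fix a assume a: "a \<in> code_verts (code x)"
  obtain k w where kw: "a = (k, w)" by (cases a)
  from a obtain u where "addr UNIV (Some \<circ> F) lt x a = Some u"
    unfolding code_verts_def snd_code by auto
  then have u: "(F ^^ k) x = (F ^^ length w) u" "w = path (length w) u"
    by (auto simp: kw addr_eq)
  have "rel x u = (k, path (length w) u)"
  proof (rule rel_eqI[OF u(1)])
    fix k' n' assume e: "(F ^^ k') x = (F ^^ n') u"
    show "k \<le> k'"
    proof (rule ccontr)
      assume "\<not> k \<le> k'"
      then have "length w = n' + (k - k')" using common_anc_diff[OF e u(1)] by simp
      \<comment> \<open>The earlier meeting at height \<open>k'\<close>, prolonged to height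
        \<open>k - 1\<close>: there the ancestor of \<open>x\<close> is the very child into which
        the word first descends.\<close>
      define m where "m = n' + (k - 1 - k')"
      with \<open>length w = _\<close> \<open>\<not> k \<le> k'\<close> have m: "length w = Suc m" "m = n' + (k - 1 - k')" by auto
      obtain j where j: "k = Suc j" using \<open>\<not> k \<le> k'\<close> by (cases k) auto
      have "(F ^^ j) x = (F ^^ m) u"
        using funpow_F_shift[OF e, of "j - k'"] \<open>\<not> k \<le> k'\<close> m j by simp
      moreover have "hd w = cidx ((F ^^ m) u)"
        using u(2) m by (metis list.sel(1) path_Suc_hd)
      moreover have "w \<noteq> []" using m by auto
      ultimately show False using a kw j unfolding code_verts_def by (auto simp: fst_code)
    qed
  qed
  then show "a \<in> range (rel x)" using u(2) kw by (metis rangeI)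
qed

lemma ball_code_verts: "(\<forall>a\<in>code_verts (code x). P a) \<longleftrightarrow> (\<forall>u. P (rel x u))"
  by (simp flip: range_rel)

lemma bex_code_verts: "(\<exists>a\<in>code_verts (code x). P a) \<longleftrightarrow> (\<exists>u. P (rel x u))"
  by (simp flip: range_rel)

lemma rel_in_code_verts: "rel x u \<in> code_verts (code x)"
  by (simp flip: range_rel)

text \<open>The left side depends on the labelled tree only through the code and two addresses,
  which is what makes order properties measurable.\<close>

lemma rls_rel: "rls up (code_lt (code x)) (rel x u) (rel x v) \<longleftrightarrow> rls F lt u v"
proof -
  have 1: "rel x v = (up ^^ k) (rel x u) \<longleftrightarrow> v = (F ^^ k) u" for k
    by (simp flip: rel_funpow add: rel_inj)
  have 2: "first_common_anc up (rel x u) (rel x v) = first_common_anc F u v"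
    by (intro ext) (simp add: first_common_anc_def flip: rel_funpow rel_inj[of x])
  have 3: "code_lt (code x) ((up ^^ (m - 1)) (rel x u)) ((up ^^ (n - 1)) (rel x v))
      \<longleftrightarrow> lt ((F ^^ (m - 1)) u) ((F ^^ (n - 1)) v)" if "first_common_anc F u v m n" for m n
  proof -
    have "F ((F ^^ (m - 1)) u) = F ((F ^^ (n - 1)) v)"
      using that unfolding first_common_anc_def
      by (metis One_nat_def Suc_pred funpow.simps(2) less_eq_Suc_le o_apply)
    then show ?thesis by (simp add: lt_iff_cidx code_lt_def idx_rel flip: rel_funpow)
  qed
  show ?thesis unfolding rls_def 1 2 using 3 by blast
qed

end

subsection \<open>Enumeration along the integers\<close>

text \<open>Choose \<open>y\<close> with the fewest elements between \<open>x\<close> and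
  \<open>y\<close>; any element strictly between would do better.\<close>

lemma ex_immediate_successor:
  assumes trans: "\<And>x y z. R x y \<Longrightarrow> R y z \<Longrightarrow> R x z" and irrefl: "\<And>x. \<not> R x x"
    and fin: "\<And>x y. finite {w. R x w \<and> R w y}" and "\<exists>y. R x y"
  shows "\<exists>y. R x y \<and> (\<forall>v. R x v \<longrightarrow> \<not> R v y)"
proof -
  obtain y where y: "R x y" "\<And>z. R x z \<Longrightarrow> card {w. R x w \<and> R w y} \<le> card {w. R x w \<and> R w z}"
    using assms(4) ex_has_least_nat[of "R x" _ "\<lambda>y. card {w. R x w \<and> R w y}"] by blast
  have "\<not> R v y" if "R x v" for v
  proof
    assume "R v y"
    then have "{w. R x w \<and> R w v} \<subset> {w. R x w \<and> R w y}" using trans irrefl that by blast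
    then show False using psubset_card_mono[OF fin] y(2)[OF that] by (metis not_le)
  qed
  then show ?thesis using y(1) by blast
qed

text \<open>The enumeration iterates immediate successors and predecessors from \<open>x\<close>. An
  element it missed would have a whole half of the enumeration between itself and \<open>x\<close>,
  against finiteness of intervals.\<close>

lemma int_order_iso:
  assumes trans: "\<And>x y z. R x y \<Longrightarrow> R y z \<Longrightarrow> R x z" and irrefl: "\<And>x. \<not> R x x"
    and total: "\<And>x y. x = y \<or> R x y \<or> R y x"
    and fin: "\<And>x y. finite {w. R x w \<and> R w y}"
    and up: "\<And>x. \<exists>y. R x y" and down: "\<And>x. \<exists>y. R y x"
  obtains \<phi> :: "int \<Rightarrow> 'v" where "\<phi> 0 = x" "bij \<phi>" "\<And>i j. R (\<phi> i) (\<phi> j) \<longleftrightarrow> i < j"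
proof -
  have "\<forall>x. \<exists>y. R x y \<and> (\<forall>v. R x v \<longrightarrow> \<not> R v y)"
    using ex_immediate_successor[of R] trans irrefl fin up by blast
  then obtain s where s: "\<And>x. R x (s x)" "\<And>x v. R x v \<Longrightarrow> \<not> R v (s x)" by metis
  have "\<forall>x. \<exists>y. R y x \<and> (\<forall>v. R v x \<longrightarrow> \<not> R y v)"
  proof
    fix x
    show "\<exists>y. R y x \<and> (\<forall>v. R v x \<longrightarrow> \<not> R y v)"
    proof (rule ex_immediate_successor[of "\<lambda>x y. R y x"])
      show "finite {w. R w x \<and> R y w}" for x y using fin[of y x] by (simp add: conj_commute)
    qed (use trans irrefl down in blast)+
  qed
  then obtain p where p: "\<And>x. R (p x) x" "\<And>x v. R v x \<Longrightarrow> \<not> R (p x) v" by metis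
  \<comment> \<open>This makes the recursion \<open>step\<close> hold at negative positions as
    well.\<close>
  have sp: "s (p x) = x" for x using total[of "s (p x)" x] s p by blast
  define \<phi> where "\<phi> n = (if n \<ge> 0 then (s ^^ nat n) x else (p ^^ nat (- n)) x)" for n
  have step: "\<phi> (n + 1) = s (\<phi> n)" for n
  proof (cases "n \<ge> 0")
    case True
    then have "nat (n + 1) = Suc (nat n)" by simp
    then show ?thesis using True by (simp add: \<phi>_def)
  next
    case False
    then have "nat (- n) = Suc (nat (- (n + 1)))" by simp
    then have "\<phi> n = p ((p ^^ nat (- (n + 1))) x)" using False by (simp only: \<phi>_def) simp
    then have "s (\<phi> n) = (p ^^ nat (- (n + 1))) x" using sp by simp
    moreover have "n + 1 = 0 \<or> n + 1 < 0" using False by linarith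
    ultimately show ?thesis by (auto simp: \<phi>_def)
  qed
  have "R (\<phi> i) (\<phi> (i + 1 + int k))" for i k
  proof (induction k)
    case 0 then show ?case using s(1) step[of i] by simp
  next
    case (Suc k)
    have "R (\<phi> (i + 1 + int k)) (\<phi> (i + 1 + int k + 1))"
      unfolding step by (rule s(1))
    moreover have "i + 1 + int (Suc k) = i + 1 + int k + 1" by simp
    ultimately show ?case using trans[OF Suc] by metis
  qed
  then have mono: "R (\<phi> i) (\<phi> j)" if "i < j" for i j
    using that by (metis zless_iff_Suc_zadd add.assoc add.commute of_nat_Suc)
  have iff: "R (\<phi> i) (\<phi> j) \<longleftrightarrow> i < j" for i j
    using mono[of i j] mono[of j i] trans irrefl by (metis linorder_cases)
  have inj: "inj \<phi>"
    by (rule injI) (metis iff irrefl linorder_cases)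
  have surj: "v \<in> range \<phi>" for v
  proof (rule ccontr)
    assume nv: "v \<notin> range \<phi>"
    from total[of x v] have "R x v \<or> R v x" using nv by (auto simp: \<phi>_def image_iff dest: spec[of _ 0])
    then show False
    proof
      assume xv: "R x v"
      have *: "R (\<phi> (int n)) v" for n
      proof (induction n)
        case 0 then show ?case using xv by (simp add: \<phi>_def)
      next
        case (Suc n)
        have "\<phi> (int (Suc n)) = s (\<phi> (int n))" using step[of "int n"] by (simp add: add.commute)
        then show ?case using total[of v "\<phi> (int (Suc n))"] nv s(2)[OF Suc]
          by (metis rangeI)
      qed
      have "range (\<lambda>n. \<phi> (int n + 1)) \<subseteq> {w. R x w \<and> R w v}"
      proof clarify
        fix n
        have "R (\<phi> 0) (\<phi> (int n + 1))" by (rule mono) simp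
        then show "R x (\<phi> (int n + 1)) \<and> R (\<phi> (int n + 1)) v"
          using *[of "Suc n"] by (simp add: \<phi>_def[of 0] add.commute)
      qed
      moreover have "inj (\<lambda>n. \<phi> (int n + 1))" by (auto intro!: injI dest!: injD[OF inj])
      ultimately show False using finite_subset[OF _ fin[of x v]] range_inj_infinite by blast
    next
      assume vx: "R v x"
      have *: "R v (\<phi> (- int n))" for n
      proof (induction n)
        case 0 then show ?case using vx by (simp add: \<phi>_def)
      next
        case (Suc n)
        have "\<phi> (- int n) = s (\<phi> (- int (Suc n)))" using step[of "- int (Suc n)"] by simp
        then have "\<not> R (\<phi> (- int (Suc n))) v" using s(2)[of "\<phi> (- int (Suc n))" v] Suc by auto
        then show ?case using total[of v "\<phi> (- int (Suc n))"] nv by (metis rangeI)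
      qed
      have "range (\<lambda>n. \<phi> (- int (Suc n))) \<subseteq> {w. R v w \<and> R w x}"
      proof clarify
        fix n
        have "R (\<phi> (- int (Suc n))) (\<phi> 0)" by (rule mono) simp
        then show "R v (\<phi> (- int (Suc n))) \<and> R (\<phi> (- int (Suc n))) x"
          using *[of "Suc n"] by (simp add: \<phi>_def[of 0])
      qed
      moreover have "inj (\<lambda>n. \<phi> (- int (Suc n)))" by (auto intro!: injI dest!: injD[OF inj])
      ultimately show False using finite_subset[OF _ fin[of v x]] range_inj_infinite by blast
    qed
  qed
  show thesis
    by (rule that[OF _ _ iff]) (use inj surj in \<open>auto simp: bij_def \<phi>_def[of 0]\<close>)
qed

section \<open>Finite intervals from a unique succession line\<close>

context eft
begin

lemma is_a_unique: "is_a F lt u v \<Longrightarrow> is_a F lt u w \<Longrightarrow> v = w"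
  unfolding is_a_def using rls_asym by blast

lemma is_b_unique: "is_b F lt u v \<Longrightarrow> is_b F lt u w \<Longrightarrow> v = w"
  unfolding is_b_def using rls_asym by blast

lemma astep_eq: "is_a F lt u v \<Longrightarrow> astep F lt u = v"
  unfolding astep_def using is_a_unique by (metis the_equality)

lemma bstep_le: "bstep F lt u = u \<or> rls F lt (bstep F lt u) u"
proof (cases "\<exists>v. is_b F lt u v")
  case True
  then obtain v where "is_b F lt u v" by blast
  moreover from this have "bstep F lt u = v" unfolding bstep_def using is_b_unique by (metis the_equality)
  ultimately show ?thesis unfolding is_b_def by simp
qed (simp add: bstep_def)

lemma funpow_bstep_le: "(bstep F lt ^^ k) u = u \<or> rls F lt ((bstep F lt ^^ k) u) u"
proof (induction k)
  case (Suc k)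
  then show ?case using bstep_le[of "(bstep F lt ^^ k) u"] rls_trans by auto
qed simp

text \<open>A single line means that the sequence started at any \<open>x\<close> visits every
  vertex. Backward steps never go up, so a vertex above \<open>x\<close> is a forward iterate of
  \<open>x\<close>, and since forward steps are immediate successors an interval contains only
  finitely many iterates.\<close>

lemma finite_interval_unique_line:
  assumes "unique_succession_line F lt"
  shows "finite {w. rls F lt u w \<and> rls F lt w v}"
proof -
  have line: "succ_line F lt x = UNIV" for x
  proof -
    have "y \<in> succ_line F lt y" for y
      unfolding succ_line_def by (rule range_eqI[of _ _ 0]) (simp add: succ_seq_def)
    then show ?thesis using assms unfolding unique_succession_line_def by blast
  qed
  have above: "\<exists>n. y = (astep F lt ^^ n) x" if "rls F lt x y" for x y
  proof -
    obtain n where n: "y = succ_seq F lt x n" using line[of x] unfolding succ_line_def by blast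
    have "n \<ge> 0"
    proof (rule ccontr)
      assume "\<not> n \<ge> 0"
      then have "y = x \<or> rls F lt y x" using n funpow_bstep_le[of "nat (- n)" x] by (simp add: succ_seq_def)
      then show False using that rls_asym rls_irrefl by blast
    qed
    then show ?thesis using n by (auto simp: succ_seq_def)
  qed
  \<comment> \<open>Without a successor \<open>astep\<close> stays at \<open>x\<close> by default
    and could not reach \<open>F x\<close>, which lies above \<open>x\<close>.\<close>
  have ex: "\<exists>y. is_a F lt x y" for x
  proof (rule ccontr)
    assume "\<nexists>y. is_a F lt x y"
    then have "astep F lt x = x" by (simp add: astep_def)
    then have "(astep F lt ^^ n) x = x" for n by (induction n) auto
    then have "F x = x" using above[OF rls_F[of x]] by auto
    then show False using F_neq by blast
  qed
  have astep: "is_a F lt x (astep F lt x)" for x using ex[of x] astep_eq by auto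
  have *: "w \<in> (\<lambda>j. (astep F lt ^^ j) u) ` {..n}"
    if "rls F lt u w" "w = (astep F lt ^^ n) u \<or> rls F lt w ((astep F lt ^^ n) u)" for w n
    using that
  proof (induction n)
    case 0
    then show ?case using rls_asym by auto
  next
    case (Suc n)
    show ?case
    proof (cases "w = (astep F lt ^^ n) u \<or> rls F lt w ((astep F lt ^^ n) u)")
      case True
      then show ?thesis using Suc by (auto simp: image_iff intro: le_SucI)
    next
      case False
      then have "rls F lt ((astep F lt ^^ n) u) w" using rls_total by blast
      then have "w = (astep F lt ^^ Suc n) u \<or> rls F lt ((astep F lt ^^ Suc n) u) w"
        using astep[of "(astep F lt ^^ n) u"] unfolding is_a_def by auto
      then have "w = (astep F lt ^^ Suc n) u" using Suc.prems rls_asym by blast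
      then show ?thesis by blast
    qed
  qed
  show ?thesis
  proof (cases "rls F lt u v")
    case True
    then obtain n where "v = (astep F lt ^^ n) u" using above by blast
    then have "{w. rls F lt u w \<and> rls F lt w v} \<subseteq> (\<lambda>j. (astep F lt ^^ j) u) ` {..n}" using * by blast
    then show ?thesis by (rule finite_subset) simp
  next
    case False
    then have "{w. rls F lt u w \<and> rls F lt w v} = {}" using rls_trans by blast
    then show ?thesis by (simp only: finite.emptyI)
  qed
qed

text \<open>Together with \<open>rls_F\<close>, which excludes a maximum, this gives order type of
  the integers. Both alternatives of the theorem are reduced to it.\<close>

definition int_like :: bool where
  "int_like \<longleftrightarrow> (\<forall>u v. finite {w. rls F lt u w \<and> rls F lt w v}) \<and> (\<forall>u. \<exists>v. rls F lt v u)"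

lemma int_like_enum:
  assumes int_like
  obtains \<phi> :: "int \<Rightarrow> 'v" where "\<phi> 0 = x" "bij \<phi>" "\<And>i j. rls F lt (\<phi> i) (\<phi> j) \<longleftrightarrow> i < j"
proof (rule int_order_iso[of "rls F lt" x thesis])
  show "\<exists>y. rls F lt u y" for u using rls_F by blast
  show "\<exists>y. rls F lt y u" for u using assms unfolding int_like_def by blast
  show "finite {w. rls F lt u w \<and> rls F lt w v}" for u v using assms unfolding int_like_def by blast
qed (use rls_trans rls_irrefl rls_total that in blast)+

end

subsection \<open>The tree as a record graph\<close>

text \<open>An isomorphism carries child indices, hence paths, hence addresses. The orders are
  matched on siblings only, because \<open>lt\<close> is unconstrained elsewhere while
  \<open><\<close> on the integers compares everything.\<close>

lemma tree_code_iso: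
  assumes F: "ordered_EFT F lt" and G: "ordered_EFT G lt'" and f: "bij f"
    and hom: "\<And>i. f (G i) = F (f i)"
    and lt: "\<And>i j. G i = G j \<Longrightarrow> lt' i j \<longleftrightarrow> lt (f i) (f j)"
  shows "tree_code UNIV (Some \<circ> G) lt' x = tree_code UNIV (Some \<circ> F) lt (f x)"
proof -
  interpret A: eft F lt by (unfold_locales) (rule F)
  interpret B: eft G lt' by (unfold_locales) (rule G)
  have f_eq: "f a = f b \<longleftrightarrow> a = b" for a b using f by (auto simp: bij_def inj_def)
  have f_surj: "\<exists>a. b = f a" for b using f by (auto simp: bij_def surj_def)
  have G_eq: "F (f a) = F (f b) \<longleftrightarrow> G a = G b" for a b by (simp flip: hom add: f_eq)
  have pow: "(F ^^ n) (f a) = f ((G ^^ n) a)" for n a by (induction n) (auto simp: hom)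
  have kids: "{u. F u = f v} = f ` {a. G a = v}" for v
    using f_surj by (auto simp: image_iff simp flip: hom) (metis f_eq hom)+
  have card_kids: "card {u. F u = f v} = card {a. G a = v}" for v
    unfolding kids by (rule card_image) (auto simp: inj_on_def f_eq)
  have "{u'. F u' = F (f a) \<and> lt u' (f a)} = f ` {a'. G a' = G a \<and> lt' a' a}" for a
  proof (intro set_eqI iffI)
    fix u assume u: "u \<in> {u'. F u' = F (f a) \<and> lt u' (f a)}"
    obtain b where "u = f b" using f_surj by blast
    then show "u \<in> f ` {a'. G a' = G a \<and> lt' a' a}" using u lt G_eq by auto
  qed (use lt G_eq in auto)
  then have cidx: "A.cidx (f a) = B.cidx a" for a
    unfolding A.cidx_eq B.cidx_eq by (simp add: card_image inj_on_def f_eq)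
  have path: "A.path n (f a) = B.path n a" for n a
  proof (induction n arbitrary: a)
    case (Suc n)
    have "A.path (Suc n) (f a) = A.path n (f (G a)) @ [A.cidx (f a)]" by (simp add: hom)
    then show ?case by (simp only: Suc.IH cidx B.path.simps)
  qed simp
  have addr_iff: "addr UNIV (Some \<circ> F) lt (f x) a = Some (f b) \<longleftrightarrow> addr UNIV (Some \<circ> G) lt' x a = Some b" for a b
    by (cases a) (simp only: A.addr_eq B.addr_eq pow path f_eq)
  have addr: "addr UNIV (Some \<circ> F) lt (f x) a = map_option f (addr UNIV (Some \<circ> G) lt' x a)" for a
  proof (cases "addr UNIV (Some \<circ> G) lt' x a")
    case None
    then show ?thesis using addr_iff[of a] f_surj by (metis not_None_eq option.simps(8))
  next
    case (Some b)
    then show ?thesis using addr_iff[of a b] by simp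
  qed
  show ?thesis
  proof (rule prod_eqI; rule ext)
    show "fst (B.code x) k = fst (A.code (f x)) k" for k
      by (simp only: A.fst_code B.fst_code pow cidx)
    show "snd (B.code x) a = snd (A.code (f x)) a" for a
      unfolding A.snd_code B.snd_code addr option.map_comp by (simp add: card_kids o_def)
  qed
qed

lemma rec_R_eqI:
  assumes "i < m" "(\<Sum>l\<in>{i..<m}. y l) \<ge> 0" "\<And>n. i < n \<Longrightarrow> n < m \<Longrightarrow> (\<Sum>l\<in>{i..<n}. y l) < 0"
  shows "rec_R y i = m"
proof -
  have "Inf {n. n > i \<and> (\<Sum>l\<in>{i..<n}. y l) \<ge> 0} = m"
    by (rule cInf_eq_minimum) (use assms in \<open>force intro: leI\<close>)+
  then show ?thesis unfolding rec_R_def using assms(1,2) by auto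
qed

text \<open>Summing the numbers of children over \<open>{i<..n}\<close> counts the vertices whose parent lies there.
  Nesting forces these to lie in \<open>{i<..<n}\<close> as long as \<open>n\<close> is before the parent of \<open>i\<close>.\<close>

lemma rec_R_parent:
  fixes q :: "int \<Rightarrow> int"
  assumes gt: "\<And>i. i < q i" and nest: "\<And>i j. i < j \<Longrightarrow> j < q i \<Longrightarrow> q j \<le> q i"
    and fin: "\<And>l. finite {j. q j = l}"
    and y: "\<And>n. y n = int (card {j. q j = n + 1}) - 1"
  shows "rec_R y i = q i"
proof -
  have sum: "(\<Sum>l\<in>{i..<n}. y l) = int (card {j. i < q j \<and> q j \<le> n}) - (n - i)" if "i < n" for n
  proof -
    have "(\<Sum>l\<in>{i..<n}. int (card {j. q j = l + 1})) = (\<Sum>l\<in>{i<..n}. int (card {j. q j = l}))"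
      by (rule sum.reindex_bij_witness[of _ "\<lambda>l. l - 1" "\<lambda>l. l + 1"]) auto
    also have "\<dots> = int (card (\<Union>l\<in>{i<..n}. {j. q j = l}))"
      by (subst card_UN_disjoint) (use fin in auto)
    also have "(\<Union>l\<in>{i<..n}. {j. q j = l}) = {j. i < q j \<and> q j \<le> n}" by auto
    finally show ?thesis using that by (simp add: y sum_subtractf)
  qed
  have fin': "finite {j. i < q j \<and> q j \<le> n}" for n
  proof -
    have "{j. i < q j \<and> q j \<le> n} = (\<Union>l\<in>{i<..n}. {j. q j = l})" by auto
    then show ?thesis using fin by simp
  qed
  show ?thesis
  proof (rule rec_R_eqI[OF gt])
    \<comment> \<open>At \<open>n = q i\<close> each of the \<open>q i - i\<close> positions from
      \<open>i\<close> on has its parent in the window, so the count compensates the subtracted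
      length.\<close>
    have "{i..<q i} \<subseteq> {j. i < q j \<and> q j \<le> q i}"
    proof
      fix j assume j: "j \<in> {i..<q i}"
      then have "i < q j" using gt[of j] by simp
      moreover have "q j \<le> q i" using nest[of i j] j by (cases "i = j") auto
      ultimately show "j \<in> {j. i < q j \<and> q j \<le> q i}" by simp
    qed
    then have "card {i..<q i} \<le> card {j. i < q j \<and> q j \<le> q i}" by (rule card_mono[OF fin'])
    then show "(\<Sum>l\<in>{i..<q i}. y l) \<ge> 0" using sum[OF gt] gt[of i] by simp
  next
    fix n assume n: "i < n" "n < q i"
    \<comment> \<open>Before the parent of \<open>i\<close>, neither \<open>i\<close> nor anything
      to its left is counted, and \<open>n\<close> itself has its parent later. At most
      \<open>n - i - 1\<close> positions remain, one too few.\<close>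
    have "{j. i < q j \<and> q j \<le> n} \<subseteq> {i<..<n}"
    proof
      fix j assume j: "j \<in> {j. i < q j \<and> q j \<le> n}"
      have "\<not> j < i" using nest[of j i] j n by auto
      moreover have "j \<noteq> i" using j n by auto
      ultimately show "j \<in> {i<..<n}" using gt[of j] j by auto
    qed
    then have "card {j. i < q j \<and> q j \<le> n} \<le> card {i<..<n}" by (intro card_mono) auto
    then show "(\<Sum>l\<in>{i..<n}. y l) < 0" using sum[OF n(1)] n by simp
  qed
qed

lemma record_comp_UNIV:
  assumes R: "\<And>i. rec_R y i = q i" "\<And>i. q i \<noteq> i"
    and conn: "\<And>j. \<exists>m n. (q ^^ m) 0 = (q ^^ n) j"
  shows "record_comp y = UNIV"
proof -
  let ?E = "\<lambda>a b. record_edge y a b \<or> record_edge y b a"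
  have edge: "?E a (q a)" "?E (q a) a" for a unfolding record_edge_def using R by auto
  have up: "?E\<^sup>*\<^sup>* a ((q ^^ n) a)" for n a
    by (induction n) (use edge(1) in \<open>auto intro: rtranclp.rtrancl_into_rtrancl\<close>)
  have down: "?E\<^sup>*\<^sup>* ((q ^^ n) a) a" for n a
    by (induction n) (use edge(2) in \<open>auto intro: converse_rtranclp_into_rtranclp\<close>)
  have "?E\<^sup>*\<^sup>* 0 j" for j
  proof -
    obtain m n where "(q ^^ m) 0 = (q ^^ n) j" using conn by blast
    then show ?thesis using up[of 0 m] down[of n j] by (metis (no_types, lifting) rtranclp_trans)
  qed
  then show ?thesis unfolding record_comp_def by blast
qed

text \<open>Pull the parent map back along \<open>\<phi>\<close> to \<open>q\<close> on the
  integers. By \<open>rec_R_parent\<close> the record graph of the degree sequence is the tree of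
  \<open>q\<close>, and \<open>\<phi>\<close> is an isomorphism from it onto the given tree.\<close>

lemma (in eft) record_code_enum:
  assumes \<phi>: "bij \<phi>" "\<And>i j. rls F lt (\<phi> i) (\<phi> j) \<longleftrightarrow> i < j"
  shows "record_code (\<lambda>n. int (card {u. F u = \<phi> (n + 1)}) - 1) = code (\<phi> (0 :: int))"
proof -
  define q where "q i = inv \<phi> (F (\<phi> i))" for i
  have inj: "\<phi> a = \<phi> b \<longleftrightarrow> a = b" for a b using \<phi>(1) by (auto simp: bij_def inj_def)
  have \<phi>q: "\<phi> (q i) = F (\<phi> i)" for i
    unfolding q_def using \<phi>(1) by (simp add: bij_def surj_f_inv_f)
  have q_iff: "q j = l \<longleftrightarrow> F (\<phi> j) = \<phi> l" for j l by (simp flip: inj add: \<phi>q)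
  have pow: "\<phi> ((q ^^ n) i) = (F ^^ n) (\<phi> i)" for n i by (induction n) (auto simp: \<phi>q)
  have pow_iff: "(q ^^ m) i = (q ^^ n) j \<longleftrightarrow> (F ^^ m) (\<phi> i) = (F ^^ n) (\<phi> j)" for m n i j
    by (simp flip: inj add: pow)
  have kids: "{u. F u = \<phi> l} = \<phi> ` {j. q j = l}" for l
  proof (intro set_eqI iffI)
    fix u assume u: "u \<in> {u. F u = \<phi> l}"
    obtain j where "u = \<phi> j" using \<phi>(1) by (metis bij_def surjD)
    then show "u \<in> \<phi> ` {j. q j = l}" using u q_iff by auto
  qed (auto simp: q_iff)
  have card: "card {u. F u = \<phi> l} = card {j. q j = l}" for l
    unfolding kids by (rule card_image) (auto simp: inj_on_def inj)
  have fin: "finite {j. q j = l}" for l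
    using finite_children[of "\<phi> l"] unfolding kids by (rule finite_imageD) (auto simp: inj_on_def inj)
  have gt: "i < q i" for i using \<phi>(2)[of i "q i"] rls_F by (simp add: \<phi>q)
  have nest: "q j \<le> q i" if "i < j" "j < q i" for i j
    using rls_nesting[of "\<phi> i" "\<phi> j"] that unfolding \<phi>(2)[symmetric] \<phi>q
    by (metis \<phi>(2) \<phi>q inj order.order_iff_strict)
  have conn: "\<exists>m n. (q ^^ m) i = (q ^^ n) j" for i j unfolding pow_iff by (rule connected)
  have G: "ordered_EFT q (<)"
    unfolding ordered_EFT_def
  proof (intro conjI allI impI)
    fix u and k :: nat assume "k > 0"
    then have "(F ^^ k) (\<phi> u) \<noteq> \<phi> u" by (rule acyclic)
    then show "(q ^^ k) u \<noteq> u" by (simp flip: inj add: pow)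
  qed (use conn fin in auto)
  have lt: "i < j \<longleftrightarrow> lt (\<phi> i) (\<phi> j)" if "q i = q j" for i j
  proof -
    have e: "F (\<phi> i) = F (\<phi> j)" using that by (simp flip: \<phi>q)
    have "rls F lt (\<phi> i) (\<phi> j)" if "lt (\<phi> i) (\<phi> j)" using rls_ltI[of 0 _ 0] e that by simp
    moreover have "rls F lt (\<phi> j) (\<phi> i)" if "lt (\<phi> j) (\<phi> i)" using rls_ltI[of 0 _ 0] e that by simp
    ultimately show ?thesis using lt_total[OF e] lt_irrefl unfolding \<phi>(2) inj by force
  qed
  let ?y = "\<lambda>n. int (card {u. F u = \<phi> (n + 1)}) - 1"
  have R: "rec_R ?y i = q i" for i
    by (rule rec_R_parent[OF gt nest fin]) (auto simp: card)
  have "q i \<noteq> i" for i using gt[of i] by simp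
  then have "record_par ?y = Some \<circ> q" by (auto simp: record_par_def R)
  moreover have "record_comp ?y = UNIV"
    by (rule record_comp_UNIV[OF R]) (use \<open>\<And>i. q i \<noteq> i\<close> conn in auto)
  ultimately have "record_code ?y = tree_code UNIV (Some \<circ> q) (<) 0" by (simp add: record_code_def)
  also have "\<dots> = code (\<phi> 0)"
    by (rule tree_code_iso[OF eft G \<phi>(1)]) (use \<phi>q lt in auto)
  finally show ?thesis .
qed

subsection \<open>Tree predicates as functions of the code\<close>

lemma measurable_fst_code [measurable]: "(\<lambda>c. fst c k) \<in> measurable code_space (count_space UNIV)"
  unfolding code_space_def by measurable

lemma measurable_snd_code [measurable]: "(\<lambda>c. snd c a) \<in> measurable code_space (count_space UNIV)"
  unfolding code_space_def by measurable

lemma pred_code_verts [measurable]: "Measurable.pred code_space (\<lambda>c. a \<in> code_verts c)"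
  unfolding code_verts_def by simp

lemma measurable_idx [measurable]: "(\<lambda>c. idx c a) \<in> measurable code_space (count_space UNIV)"
  unfolding idx_def
  by (cases "snd a = []") (simp_all add: measurable_compose[OF measurable_fst_code, of the])

text \<open>Since \<open>up\<close> does not involve the code, ancestry conditions are constant;
  only sibling comparisons vary with \<open>c\<close>, under countable quantifiers.\<close>

lemma pred_rls_code [measurable]: "Measurable.pred code_space (\<lambda>c. rls up (code_lt c) a b)"
proof -
  have eq: "code_lt c x y \<longleftrightarrow> (\<exists>i j. idx c x = i \<and> idx c y = j \<and> i < j)" for c x y
    by (simp add: code_lt_def)
  have *: "Measurable.pred code_space (\<lambda>c. code_lt c x y)" for x y
    unfolding eq by measurable
  show ?thesis unfolding rls_def
    by (intro pred_intros_logic pred_intros_countable *) auto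
qed

definition code_succ :: "tcode \<Rightarrow> tree_addr \<Rightarrow> tree_addr \<Rightarrow> bool" where
  "code_succ c a b \<longleftrightarrow> rls up (code_lt c) a b \<and>
     (\<forall>v\<in>code_verts c. rls up (code_lt c) a v \<longrightarrow> v = b \<or> rls up (code_lt c) b v)"

text \<open>Positions on the succession line are described as relations rather than by iterating a
  choice of successor, so each stage is a countable union of measurable events.\<close>

primrec code_fwd :: "tcode \<Rightarrow> nat \<Rightarrow> tree_addr \<Rightarrow> bool" where
  "code_fwd c 0 a \<longleftrightarrow> a = (0, [])"
| "code_fwd c (Suc n) a \<longleftrightarrow> (\<exists>b\<in>code_verts c. code_fwd c n b \<and> code_succ c b a)"

primrec code_bwd :: "tcode \<Rightarrow> nat \<Rightarrow> tree_addr \<Rightarrow> bool" where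
  "code_bwd c 0 a \<longleftrightarrow> a = (0, [])"
| "code_bwd c (Suc n) a \<longleftrightarrow> (\<exists>b\<in>code_verts c. code_bwd c n b \<and> code_succ c a b)"

definition code_pos :: "tcode \<Rightarrow> int \<Rightarrow> tree_addr \<Rightarrow> bool" where
  "code_pos c n a \<longleftrightarrow> (if n \<ge> 0 then code_fwd c (nat n) a else code_bwd c (nat (- n)) a)"

text \<open>The shift by one in the definition puts the degree of the vertex at position \<open>n + 1\<close> of the
  succession line at time \<open>n\<close>: the successor of \<open>n\<close> is its parent iff it has a child.\<close>

definition code_seq :: "tcode \<Rightarrow> int \<Rightarrow> int" where
  "code_seq c n = int (LEAST d. \<exists>a\<in>code_verts c. code_pos c (n + 1) a \<and> snd c a = Some (enat d)) - 1"

definition code_min :: "tcode \<Rightarrow> tree_addr \<Rightarrow> bool" where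
  "code_min c a \<longleftrightarrow> (\<forall>b\<in>code_verts c. b = a \<or> rls up (code_lt c) a b)"

definition code_deep :: "tcode \<Rightarrow> tree_addr \<Rightarrow> bool" where
  "code_deep c a \<longleftrightarrow> (\<forall>n. \<exists>b\<in>code_verts c. (up ^^ n) b = a)"

definition code_branching :: "tcode \<Rightarrow> tree_addr \<Rightarrow> bool" where
  "code_branching c a \<longleftrightarrow> (\<exists>b\<in>code_verts c. \<exists>b'\<in>code_verts c.
     b \<noteq> b' \<and> up b = a \<and> up b' = a \<and> code_deep c b \<and> code_deep c b')"

lemma pred_code_succ [measurable]: "Measurable.pred code_space (\<lambda>c. code_succ c a b)"
  unfolding code_succ_def Ball_def by measurable

lemma pred_code_fwd [measurable]: "Measurable.pred code_space (\<lambda>c. code_fwd c n a)"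
  by (induction n arbitrary: a) (simp_all add: Bex_def)

lemma pred_code_bwd [measurable]: "Measurable.pred code_space (\<lambda>c. code_bwd c n a)"
  by (induction n arbitrary: a) (simp_all add: Bex_def)

lemma pred_code_pos [measurable]: "Measurable.pred code_space (\<lambda>c. code_pos c n a)"
  unfolding code_pos_def by (cases "n \<ge> 0") simp_all

lemma pred_code_min [measurable]: "Measurable.pred code_space (\<lambda>c. code_min c a)"
  unfolding code_min_def Ball_def by measurable

lemma pred_code_deep [measurable]: "Measurable.pred code_space (\<lambda>c. code_deep c a)"
  unfolding code_deep_def Bex_def by measurable

lemma pred_code_branching [measurable]: "Measurable.pred code_space (\<lambda>c. code_branching c a)"
  unfolding code_branching_def Bex_def by measurable

lemma measurable_code_seq [measurable]: "code_seq \<in> measurable code_space seq_space"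
proof -
  have "(\<lambda>c. code_seq c n) \<in> measurable code_space (count_space UNIV)" for n
    unfolding code_seq_def Bex_def by measurable
  then show ?thesis
    unfolding seq_space_def by (intro measurable_PiM_single') auto
qed

section \<open>Meaning of the code predicates on the tree\<close>

context eft
begin

lemma code_succ_rel: "code_succ (code x) (rel x u) (rel x v) \<longleftrightarrow> is_a F lt u v"
  unfolding code_succ_def is_a_def ball_code_verts rls_rel rel_inj ..

lemma code_min_rel: "code_min (code x) (rel x u) \<longleftrightarrow> (\<forall>v. v = u \<or> rls F lt u v)"
  unfolding code_min_def ball_code_verts rls_rel rel_inj ..

lemma code_deep_rel: "code_deep (code x) (rel x u) \<longleftrightarrow> deep u"
  unfolding code_deep_def deep_def bex_code_verts rel_funpow[symmetric] rel_inj ..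

lemma code_branching_rel:
  "code_branching (code x) (rel x u) \<longleftrightarrow> (\<exists>a b. a \<noteq> b \<and> F a = u \<and> F b = u \<and> deep a \<and> deep b)"
  unfolding code_branching_def code_deep_rel bex_code_verts rel_F[symmetric] rel_inj ..

lemma foil_rel: "rel x v \<in> foil up (rel x u) \<longleftrightarrow> v \<in> foil F u"
  unfolding foil_def mem_Collect_eq rel_funpow[symmetric] rel_inj ..

lemma is_a_enum:
  assumes "bij \<phi>" "\<And>i j. rls F lt (\<phi> i) (\<phi> j) \<longleftrightarrow> i < j"
  shows "is_a F lt (\<phi> i) (\<phi> j) \<longleftrightarrow> j = i + (1 :: int)"
proof -
  have all: "(\<forall>v. P v) \<longleftrightarrow> (\<forall>k. P (\<phi> k))" for P using assms(1) by (metis bij_pointE)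
  have inj: "\<phi> a = \<phi> b \<longleftrightarrow> a = b" for a b using assms(1) by (auto simp: bij_def inj_def)
  have "(i < j \<and> (\<forall>k. i < k \<longrightarrow> k = j \<or> j < k)) \<longleftrightarrow> j = i + 1"
    by (auto dest: spec[of _ "i + 1"])
  then show ?thesis unfolding is_a_def all assms(2) inj .
qed

lemma code_pos_enum:
  assumes "bij \<phi>" "\<And>i j. rls F lt (\<phi> i) (\<phi> j) \<longleftrightarrow> i < j"
  shows "code_pos (code (\<phi> i)) n (rel (\<phi> i) (\<phi> j)) \<longleftrightarrow> j = i + n"
proof -
  have ex: "(\<exists>v. P v) \<longleftrightarrow> (\<exists>k. P (\<phi> k))" for P using assms(1) by (metis bij_pointE)
  have inj: "\<phi> a = \<phi> b \<longleftrightarrow> a = b" for a b using assms(1) by (auto simp: bij_def inj_def)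
  have 0: "rel (\<phi> i) (\<phi> j) = (0, []) \<longleftrightarrow> j = i" for j
    by (simp add: inj rel_inj flip: rel_self[of "\<phi> i"])
  have f: "code_fwd (code (\<phi> i)) n (rel (\<phi> i) (\<phi> j)) \<longleftrightarrow> j = i + int n" for n j
  proof (induction n arbitrary: j)
    case (Suc n)
    show ?case
      unfolding code_fwd.simps bex_code_verts code_succ_rel ex is_a_enum[OF assms] Suc by auto
  qed (simp only: code_fwd.simps 0, simp)
  have b: "code_bwd (code (\<phi> i)) n (rel (\<phi> i) (\<phi> j)) \<longleftrightarrow> j = i - int n" for n j
  proof (induction n arbitrary: j)
    case (Suc n)
    show ?case
      unfolding code_bwd.simps bex_code_verts code_succ_rel ex is_a_enum[OF assms] Suc by auto
  qed (simp only: code_bwd.simps 0, simp)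
  show ?thesis unfolding code_pos_def f b by auto
qed

text \<open>Reading the sequence from another vertex of the line only shifts it:
  \<open>i = 0\<close> identifies it with the degrees seen from the root, \<open>i = 1\<close>
  supplies the shift for stationarity.\<close>

lemma code_seq_enum:
  assumes "bij \<phi>" "\<And>i j. rls F lt (\<phi> i) (\<phi> j) \<longleftrightarrow> i < j"
  shows "code_seq (code (\<phi> i)) n = int (card {u. F u = \<phi> (i + n + 1)}) - 1"
proof -
  have ex: "(\<exists>v. P v) \<longleftrightarrow> (\<exists>k. P (\<phi> k))" for P using assms(1) by (metis bij_pointE)
  show ?thesis
    unfolding code_seq_def bex_code_verts ex code_pos_enum[OF assms] snd_code_rel
    by (simp add: Least_equality add.assoc)
qed

end

subsection \<open>Mass transport\<close>

locale unimodular_tree = prob_space M for M :: "'w measure" +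
  fixes F :: "'w \<Rightarrow> nat \<Rightarrow> nat" and lt :: "'w \<Rightarrow> nat \<Rightarrow> nat \<Rightarrow> bool" and r :: "'w \<Rightarrow> nat"
  assumes tree: "\<omega> \<in> space M \<Longrightarrow> ordered_EFT (F \<omega>) (lt \<omega>)"
    and measurable_root_code: "(\<lambda>\<omega>. tree_code UNIV (Some \<circ> F \<omega>) (lt \<omega>) (r \<omega>)) \<in> measurable M code_space"
    and unimodular: "unimodular_EFT M F lt r"
begin

abbreviation code_at :: "'w \<Rightarrow> nat \<Rightarrow> tcode" where
  "code_at \<omega> \<equiv> tree_code UNIV (Some \<circ> F \<omega>) (lt \<omega>)"

abbreviation rel_at :: "'w \<Rightarrow> nat \<Rightarrow> nat \<Rightarrow> tree_addr" where
  "rel_at \<omega> \<equiv> rel_addr UNIV (Some \<circ> F \<omega>) (lt \<omega>)"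

lemma eft: "\<omega> \<in> space M \<Longrightarrow> eft (F \<omega>) (lt \<omega>)"
  by unfold_locales (rule tree)

lemma pred_code: "Measurable.pred code_space p \<Longrightarrow> Measurable.pred M (\<lambda>\<omega>. p (code_at \<omega> (r \<omega>)))"
  by (rule measurable_compose[OF measurable_root_code])

text \<open>In its own code the root has the address \<open>(0, [])\<close>, so a property of the
  root vertex becomes an event about its code.\<close>

lemma pred_root:
  assumes "Measurable.pred code_space (\<lambda>c. p c (0, []))"
    and "\<And>\<omega> x u. \<omega> \<in> space M \<Longrightarrow> p (code_at \<omega> x) (rel_at \<omega> x u) \<longleftrightarrow> Q \<omega> u"
  shows "Measurable.pred M (\<lambda>\<omega>. Q \<omega> (r \<omega>))"
proof -
  have "p (code_at \<omega> (r \<omega>)) (0, []) \<longleftrightarrow> Q \<omega> (r \<omega>)" if "\<omega> \<in> space M" for \<omega>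
    using assms(2)[OF that] eft.rel_self[OF eft[OF that]] by metis
  then show ?thesis using pred_code[OF assms(1)] by (simp cong: measurable_cong)
qed

text \<open>Unimodularity for masses 0 and 1: \<open>p\<close> decides the transport on addresses,
  \<open>P\<close> on vertices. Measurability at each fixed address suffices because there are
  countably many addresses.\<close>

lemma mass_transport:
  assumes p: "\<And>a. Measurable.pred code_space (\<lambda>c. p c a)"
    and P: "\<And>\<omega> x u. \<omega> \<in> space M \<Longrightarrow> p (code_at \<omega> x) (rel_at \<omega> x u) \<longleftrightarrow> P \<omega> x u"
  shows "(\<integral>\<^sup>+ \<omega>. emeasure (count_space UNIV) {u. P \<omega> (r \<omega>) u} \<partial>M) =
    (\<integral>\<^sup>+ \<omega>. emeasure (count_space UNIV) {u. P \<omega> u (r \<omega>)} \<partial>M)"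
proof -
  define h where "h = (\<lambda>(c, a). indicator {c. p c a} c :: ennreal)"
  have h: "h \<in> borel_measurable (code_space \<Otimes>\<^sub>M count_space UNIV)"
    unfolding h_def case_prod_beta
  proof (rule measurable_compose_countable[where f = "\<lambda>a x. indicator {c. p c a} (fst x)" and g = snd])
    show "(\<lambda>x. indicator {c. p c a} (fst x)) \<in> borel_measurable (code_space \<Otimes>\<^sub>M count_space UNIV)" for a
      by (rule measurable_compose[OF measurable_fst]) (use p[of a] in \<open>simp add: borel_measurable_indicator_iff pred_def\<close>)
  qed simp
  have ind: "(\<integral>\<^sup>+ u. indicator {u. Q u} u \<partial>count_space UNIV) = emeasure (count_space UNIV) {u. Q u}" for Q :: "nat \<Rightarrow> bool"
    by (rule nn_integral_indicator) simp
  have 1: "(\<integral>\<^sup>+ u. h (code_at \<omega> x, rel_at \<omega> x u) \<partial>count_space UNIV) = emeasure (count_space UNIV) {u. P \<omega> x u}"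
    if "\<omega> \<in> space M" for \<omega> x
    unfolding ind[symmetric] by (rule nn_integral_cong) (simp add: h_def P[OF that] indicator_def)
  have 2: "(\<integral>\<^sup>+ u. h (code_at \<omega> u, rel_at \<omega> u x) \<partial>count_space UNIV) = emeasure (count_space UNIV) {u. P \<omega> u x}"
    if "\<omega> \<in> space M" for \<omega> x
    unfolding ind[symmetric] by (rule nn_integral_cong) (simp add: h_def P[OF that] indicator_def)
  have "(\<integral>\<^sup>+ \<omega>. (\<integral>\<^sup>+ u. h (code_at \<omega> (r \<omega>), rel_at \<omega> (r \<omega>) u) \<partial>count_space UNIV) \<partial>M) =
    (\<integral>\<^sup>+ \<omega>. (\<integral>\<^sup>+ u. h (code_at \<omega> u, rel_at \<omega> u (r \<omega>)) \<partial>count_space UNIV) \<partial>M)"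
    using unimodular h unfolding unimodular_EFT_def by blast
  then show ?thesis by (simp add: 1 2 cong: nn_integral_cong)
qed

text \<open>Let each vertex send mass 1 to every vertex satisfying \<open>Q\<close>. The root
  receives nothing unless it satisfies \<open>Q\<close> itself, so the expected number of vertices
  satisfying \<open>Q\<close> is zero.\<close>

lemma AE_all_vertices:
  assumes p: "\<And>a. Measurable.pred code_space (\<lambda>c. p c a)"
    and Q: "\<And>\<omega> x u. \<omega> \<in> space M \<Longrightarrow> p (code_at \<omega> x) (rel_at \<omega> x u) \<longleftrightarrow> Q \<omega> u"
    and root: "AE \<omega> in M. \<not> Q \<omega> (r \<omega>)"
  shows "AE \<omega> in M. \<forall>u. \<not> Q \<omega> u"
proof -
  have "(\<integral>\<^sup>+ \<omega>. emeasure (count_space UNIV) {u. Q \<omega> u} \<partial>M) =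
    (\<integral>\<^sup>+ \<omega>. emeasure (count_space UNIV) {u :: nat. Q \<omega> (r \<omega>)} \<partial>M)"
    by (rule mass_transport[of p "\<lambda>\<omega> x u. Q \<omega> u"]) (use p Q in auto)
  also have "\<dots> = (\<integral>\<^sup>+ \<omega>. 0 \<partial>M)"
    by (rule nn_integral_cong_AE) (use root in auto)
  finally have 0: "(\<integral>\<^sup>+ \<omega>. emeasure (count_space UNIV) {u. Q \<omega> u} \<partial>M) = 0" by simp
  \<comment> \<open>A vanishing integral does not give an almost sure statement directly, as the
    integrand is not known to be measurable. The measurable event at a single address has an
    indicator below the integrand, and there are countably many addresses.\<close>
  have "AE \<omega> in M. \<not> (a \<in> code_verts (code_at \<omega> (r \<omega>)) \<and> p (code_at \<omega> (r \<omega>)) a)" for a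
  proof -
    let ?S = "\<lambda>\<omega>. a \<in> code_verts (code_at \<omega> (r \<omega>)) \<and> p (code_at \<omega> (r \<omega>)) a"
    have [measurable]: "Measurable.pred M ?S"
      by (rule pred_code) (use p pred_code_verts in \<open>auto intro: pred_intros_logic\<close>)
    have "emeasure M {\<omega>\<in>space M. ?S \<omega>} = (\<integral>\<^sup>+ \<omega>. indicator {\<omega>\<in>space M. ?S \<omega>} \<omega> \<partial>M)"
      by (rule nn_integral_indicator[symmetric]) simp
    also have "\<dots> \<le> (\<integral>\<^sup>+ \<omega>. emeasure (count_space UNIV) {u. Q \<omega> u} \<partial>M)"
    proof (rule nn_integral_mono)
      fix \<omega> assume w: "\<omega> \<in> space M"
      interpret eft "F \<omega>" "lt \<omega>" using w by (rule eft)
      have "1 \<le> emeasure (count_space UNIV) {u. Q \<omega> u}" if "?S \<omega>"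
      proof -
        from that obtain u where "Q \<omega> u" using Q[OF w] range_rel[of "r \<omega>"] by (metis imageE)
        then have "emeasure (count_space UNIV) {u} \<le> emeasure (count_space UNIV) {u. Q \<omega> u}"
          by (intro emeasure_mono) auto
        then show ?thesis by simp
      qed
      then show "indicator {\<omega>\<in>space M. ?S \<omega>} \<omega> \<le> emeasure (count_space UNIV) {u. Q \<omega> u}"
        by (auto simp: indicator_def)
    qed
    finally have "emeasure M {\<omega>\<in>space M. ?S \<omega>} = 0" using 0 by simp
    then show ?thesis by (subst AE_iff_measurable[OF _ refl]) auto
  qed
  then have "AE \<omega> in M. \<forall>a. \<not> (a \<in> code_verts (code_at \<omega> (r \<omega>)) \<and> p (code_at \<omega> (r \<omega>)) a)"
    by (simp add: AE_all_countable)
  then show ?thesis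
  proof (rule AE_mp, intro AE_I2 impI allI)
    fix \<omega> u assume w: "\<omega> \<in> space M"
      and *: "\<forall>a. \<not> (a \<in> code_verts (code_at \<omega> (r \<omega>)) \<and> p (code_at \<omega> (r \<omega>)) a)"
    interpret eft "F \<omega>" "lt \<omega>" using w by (rule eft)
    show "\<not> Q \<omega> u" using * rel_in_code_verts[of "r \<omega>" u] Q[OF w, of "r \<omega>" u] by blast
  qed
qed

text \<open>At most mass 1 is sent, hence at most 1 is received on average, which leaves probability
  zero for receiving infinite mass.\<close>

lemma AE_finite_mass_received:
  assumes p: "\<And>a. Measurable.pred code_space (\<lambda>c. p c a)"
    and P: "\<And>\<omega> x u. \<omega> \<in> space M \<Longrightarrow> p (code_at \<omega> x) (rel_at \<omega> x u) \<longleftrightarrow> P \<omega> x u"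
    and q: "Measurable.pred M Q"
    and sent: "AE \<omega> in M. \<forall>u v. P \<omega> (r \<omega>) u \<longrightarrow> P \<omega> (r \<omega>) v \<longrightarrow> u = v"
    and received: "AE \<omega> in M. Q \<omega> \<longrightarrow> infinite {u. P \<omega> u (r \<omega>)}"
  shows "AE \<omega> in M. \<not> Q \<omega>"
proof -
  let ?E = "{\<omega>\<in>space M. Q \<omega>}"
  have [measurable]: "?E \<in> sets M" using q by simp
  have "\<infinity> * emeasure M ?E = (\<integral>\<^sup>+ \<omega>. \<infinity> * indicator ?E \<omega> \<partial>M)"
    by (rule nn_integral_cmult_indicator[symmetric]) simp
  also have "\<dots> \<le> (\<integral>\<^sup>+ \<omega>. emeasure (count_space UNIV) {u. P \<omega> u (r \<omega>)} \<partial>M)"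
  proof (rule nn_integral_mono_AE, use received in eventually_elim)
    fix \<omega> assume "Q \<omega> \<longrightarrow> infinite {u. P \<omega> u (r \<omega>)}"
    then show "\<infinity> * indicator ?E \<omega> \<le> emeasure (count_space UNIV) {u. P \<omega> u (r \<omega>)}"
      by (auto simp: indicator_def)
  qed
  also have "\<dots> = (\<integral>\<^sup>+ \<omega>. emeasure (count_space UNIV) {u. P \<omega> (r \<omega>) u} \<partial>M)"
    by (rule mass_transport[OF p P, symmetric])
  also have "\<dots> \<le> (\<integral>\<^sup>+ \<omega>. 1 \<partial>M)"
  proof (rule nn_integral_mono_AE, use sent in eventually_elim)
    fix \<omega> assume *: "\<forall>u v. P \<omega> (r \<omega>) u \<longrightarrow> P \<omega> (r \<omega>) v \<longrightarrow> u = v"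
    then have "{u. P \<omega> (r \<omega>) u} = {} \<or> (\<exists>u. {u. P \<omega> (r \<omega>) u} = {u})" by blast
    then show "emeasure (count_space UNIV) {u. P \<omega> (r \<omega>) u} \<le> 1" by auto
  qed
  also have "\<dots> = 1" by (simp add: emeasure_space_1)
  finally have "emeasure M ?E = 0"
    by (metis ennreal_top_mult infinity_ennreal_def ennreal_one_less_top not_less)
  then show ?thesis by (subst AE_iff_measurable[OF _ refl]) auto
qed

text \<open>A root that is the minimum receives from all of \<open>nat\<close>, an infinite mass;
  antisymmetry bounds what is sent.\<close>

lemma AE_no_minimum: "AE \<omega> in M. \<forall>u. \<exists>v. rls (F \<omega>) (lt \<omega>) v u"
proof -
  let ?Q = "\<lambda>\<omega> u. \<forall>v. v = u \<or> rls (F \<omega>) (lt \<omega>) u v"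
  have p: "\<And>\<omega> x u. \<omega> \<in> space M \<Longrightarrow> code_min (code_at \<omega> x) (rel_at \<omega> x u) \<longleftrightarrow> ?Q \<omega> u"
    by (rule eft.code_min_rel[OF eft])
  have q: "Measurable.pred M (\<lambda>\<omega>. ?Q \<omega> (r \<omega>))"
    by (rule pred_root[of code_min]) (use p in auto)
  have "AE \<omega> in M. \<not> ?Q \<omega> (r \<omega>)"
  proof (rule AE_finite_mass_received[where p = code_min and P = "\<lambda>\<omega> x u. ?Q \<omega> u"])
    show "AE \<omega> in M. \<forall>u v. ?Q \<omega> u \<longrightarrow> ?Q \<omega> v \<longrightarrow> u = v"
    proof (rule AE_I2, intro allI impI)
      fix \<omega> u v assume w: "\<omega> \<in> space M" and "?Q \<omega> u" "?Q \<omega> v"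
      then show "u = v" using eft.rls_asym[OF eft[OF w]] by metis
    qed
  qed (use p q in auto)
  then have "AE \<omega> in M. \<forall>u. \<not> ?Q \<omega> u" by (rule AE_all_vertices[where p = code_min, rotated 2]) (measurable, rule p)
  then show ?thesis
  proof (rule AE_mp, intro AE_I2 impI allI)
    fix \<omega> u assume w: "\<omega> \<in> space M" and "\<forall>u. \<not> ?Q \<omega> u"
    then show "\<exists>v. rls (F \<omega>) (lt \<omega>) v u" using eft.rls_total[OF eft[OF w]] by metis
  qed
qed

text \<open>Each deep vertex sends mass 1 to its parent. The root receives at least 1 if it is deep,
  and at least 2 if it has two deep children, so
  \<open>emeasure M SD + emeasure M SB \<le> emeasure M SD\<close>, and the finite term
  cancels.\<close>

lemma AE_no_branching:
  "AE \<omega> in M. \<forall>u. \<not> (\<exists>a b. a \<noteq> b \<and> F \<omega> a = u \<and> F \<omega> b = u \<and> eft.deep (F \<omega>) a \<and> eft.deep (F \<omega>) b)"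
proof -
  let ?D = "\<lambda>\<omega>. eft.deep (F \<omega>)"
  let ?B = "\<lambda>\<omega> u. \<exists>a b. a \<noteq> b \<and> F \<omega> a = u \<and> F \<omega> b = u \<and> ?D \<omega> a \<and> ?D \<omega> b"
  have br: "code_branching (code_at \<omega> x) (rel_at \<omega> x u) \<longleftrightarrow> ?B \<omega> u" if "\<omega> \<in> space M" for \<omega> x u
    using eft.code_branching_rel[OF eft[OF that]] .
  have dp: "code_deep (code_at \<omega> x) (rel_at \<omega> x u) \<longleftrightarrow> ?D \<omega> u" if "\<omega> \<in> space M" for \<omega> x u
    using eft.code_deep_rel[OF eft[OF that]] .
  have D: "Measurable.pred M (\<lambda>\<omega>. ?D \<omega> (r \<omega>))"
    by (rule pred_root[of code_deep]) (use dp in auto)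
  have B: "Measurable.pred M (\<lambda>\<omega>. ?B \<omega> (r \<omega>))"
    by (rule pred_root[of code_branching]) (use br in auto)
  define SD SB where "SD = {\<omega>\<in>space M. ?D \<omega> (r \<omega>)}" and "SB = {\<omega>\<in>space M. ?B \<omega> (r \<omega>)}"
  have [measurable]: "SD \<in> sets M" "SB \<in> sets M"
    unfolding SD_def SB_def using D B by (simp_all only: pred_def)
  have "emeasure M SD + emeasure M SB = (\<integral>\<^sup>+ \<omega>. indicator SD \<omega> + indicator SB \<omega> \<partial>M)"
    by (subst nn_integral_add) auto
  also have "\<dots> \<le> (\<integral>\<^sup>+ \<omega>. emeasure (count_space UNIV) {u. ?D \<omega> u \<and> r \<omega> = F \<omega> u} \<partial>M)"
  proof (rule nn_integral_mono)
    fix \<omega> assume w: "\<omega> \<in> space M"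
    interpret eft "F \<omega>" "lt \<omega>" using w by (rule eft)
    have fin: "finite {u. ?D \<omega> u \<and> r \<omega> = F \<omega> u}"
      by (rule finite_subset[OF _ finite_children[of "r \<omega>"]]) auto
    have 1: "1 \<le> card {u. ?D \<omega> u \<and> r \<omega> = F \<omega> u}" if "?D \<omega> (r \<omega>)"
    proof -
      from deep_child[OF that] obtain v where "F \<omega> v = r \<omega>" "?D \<omega> v" by blast
      then have "v \<in> {u. ?D \<omega> u \<and> r \<omega> = F \<omega> u}" by simp
      then show ?thesis using fin card_gt_0_iff[of "{u. ?D \<omega> u \<and> r \<omega> = F \<omega> u}"] by (auto simp: Suc_le_eq)
    qed
    have 2: "2 \<le> card {u. ?D \<omega> u \<and> r \<omega> = F \<omega> u}" if "?B \<omega> (r \<omega>)"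
    proof -
      from that obtain a b where "a \<noteq> b" "{a, b} \<subseteq> {u. ?D \<omega> u \<and> r \<omega> = F \<omega> u}" by auto
      then show ?thesis using card_mono[OF fin, of "{a, b}"] by simp
    qed
    have 3: "?D \<omega> (r \<omega>)" if "?B \<omega> (r \<omega>)"
    proof -
      from that obtain a where "F \<omega> a = r \<omega>" "?D \<omega> a" by (elim exE conjE)
      then show ?thesis using deep_F[of a] by simp
    qed
    let ?n = "card {u. ?D \<omega> u \<and> r \<omega> = F \<omega> u}"
    have "indicator SD \<omega> + indicator SB \<omega> =
        (of_nat ((if ?D \<omega> (r \<omega>) then 1 else 0) + (if ?B \<omega> (r \<omega>) then 1 else 0)) :: ennreal)"
      unfolding SD_def SB_def using w by (cases "?B \<omega> (r \<omega>)"; cases "?D \<omega> (r \<omega>)") (simp_all only: indicator_def mem_Collect_eq if_True if_False simp_thms of_nat_add of_nat_1 of_nat_0 of_bool_eq)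
    also have "\<dots> \<le> of_nat ?n"
    proof (rule of_nat_mono)
      show "(if ?D \<omega> (r \<omega>) then 1 else 0) + (if ?B \<omega> (r \<omega>) then 1 else 0) \<le> ?n"
      proof (cases "?B \<omega> (r \<omega>)")
        case True
        from 2[OF True] show ?thesis unfolding if_P[OF True] if_P[OF 3[OF True]] by simp
      next
        case False
        show ?thesis unfolding if_not_P[OF False] using 1 by (cases "?D \<omega> (r \<omega>)") simp_all
      qed
    qed
    also have "\<dots> = emeasure (count_space UNIV) {u. ?D \<omega> u \<and> r \<omega> = F \<omega> u}"
      using fin by simp
    finally show "indicator SD \<omega> + indicator SB \<omega> \<le> emeasure (count_space UNIV) {u. ?D \<omega> u \<and> r \<omega> = F \<omega> u}" .
  qed
  also have "\<dots> = (\<integral>\<^sup>+ \<omega>. emeasure (count_space UNIV) {u. ?D \<omega> (r \<omega>) \<and> u = F \<omega> (r \<omega>)} \<partial>M)"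
  proof (rule mass_transport[of "\<lambda>c a. code_deep c (0, []) \<and> a = up (0, [])", symmetric])
    fix \<omega> x u assume w: "\<omega> \<in> space M"
    interpret eft "F \<omega>" "lt \<omega>" using w by (rule eft)
    show "(code_deep (code_at \<omega> x) (0, []) \<and> rel_at \<omega> x u = up (0, [])) \<longleftrightarrow> ?D \<omega> x \<and> u = F \<omega> x"
      unfolding rel_self[of x, symmetric] code_deep_rel rel_F[symmetric] rel_inj ..
  qed measurable
  also have "\<dots> = (\<integral>\<^sup>+ \<omega>. indicator SD \<omega> \<partial>M)"
    by (rule nn_integral_cong) (auto simp: indicator_def SD_def)
  also have "\<dots> = emeasure M SD" by simp
  finally have "emeasure M SD + emeasure M SB \<le> emeasure M SD + 0" by simp
  then have "emeasure M SB = 0"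
    unfolding ennreal_add_left_cancel_le using emeasure_finite[of SD] by simp
  have "AE \<omega> in M. \<not> ?B \<omega> (r \<omega>)"
  proof (rule AE_I)
    show "{\<omega>\<in>space M. \<not> \<not> ?B \<omega> (r \<omega>)} \<subseteq> SB" unfolding SB_def not_not by (rule order_refl)
  qed fact+
  then show ?thesis by (rule AE_all_vertices[where p = code_branching, rotated 2]) (measurable, rule br)
qed

text \<open>Each vertex sends mass 1 to the deep vertices of its foil, of which there is at most
  one. Being in the same foil is symmetric, so a deep root receives from its entire infinite
  foil.\<close>

lemma AE_no_deep:
  assumes "AE \<omega> in M. class_II (F \<omega>)"
  shows "AE \<omega> in M. \<forall>u. \<not> eft.deep (F \<omega>) u"
proof -
  let ?D = "\<lambda>\<omega>. eft.deep (F \<omega>)"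
  have dp: "code_deep (code_at \<omega> x) (rel_at \<omega> x u) \<longleftrightarrow> ?D \<omega> u" if "\<omega> \<in> space M" for \<omega> x u
    using eft.code_deep_rel[OF eft[OF that]] .
  have D: "Measurable.pred M (\<lambda>\<omega>. ?D \<omega> (r \<omega>))"
    by (rule pred_root[of code_deep]) (use dp in auto)
  have "AE \<omega> in M. \<not> ?D \<omega> (r \<omega>)"
  proof (rule AE_finite_mass_received[OF _ _ D])
    \<comment> \<open>The sender has address \<open>(0, [])\<close> in its own code and
      \<open>foil up (0, [])\<close> is a fixed set of addresses, so only \<open>code_deep\<close>
      varies with the code.\<close>
    show "(code_deep (code_at \<omega> x) (rel_at \<omega> x u) \<and> rel_at \<omega> x u \<in> foil up (0, [])) \<longleftrightarrow> ?D \<omega> u \<and> u \<in> foil (F \<omega>) x"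
      if w: "\<omega> \<in> space M" for \<omega> x u
    proof -
      interpret eft "F \<omega>" "lt \<omega>" using w by (rule eft)
      show ?thesis unfolding rel_self[of x, symmetric] code_deep_rel foil_rel ..
    qed
    show "AE \<omega> in M. \<forall>u v. ?D \<omega> u \<and> u \<in> foil (F \<omega>) (r \<omega>) \<longrightarrow> ?D \<omega> v \<and> v \<in> foil (F \<omega>) (r \<omega>) \<longrightarrow> u = v"
      using AE_no_branching AE_space
    proof eventually_elim
      case (elim \<omega>)
      then show ?case using eft.foil_deep_unique[OF eft, of \<omega>] by metis
    qed
    show "AE \<omega> in M. ?D \<omega> (r \<omega>) \<longrightarrow> infinite {u. ?D \<omega> (r \<omega>) \<and> r \<omega> \<in> foil (F \<omega>) u}"
      using assms
    proof eventually_elim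
      case (elim \<omega>)
      have "{u. r \<omega> \<in> foil (F \<omega>) u} = foil (F \<omega>) (r \<omega>)" by (auto simp: foil_def)
      then show ?case using elim unfolding class_II_def by simp
    qed
  qed measurable
  then show ?thesis by (rule AE_all_vertices[where p = code_deep, rotated 2]) (measurable, rule dp)
qed

lemma AE_int_like:
  assumes "(AE \<omega> in M. unique_succession_line (F \<omega>) (lt \<omega>)) \<or> (AE \<omega> in M. class_II (F \<omega>))"
  shows "AE \<omega> in M. eft.int_like (F \<omega>) (lt \<omega>)"
proof -
  have "AE \<omega> in M. \<forall>u v. finite {w. rls (F \<omega>) (lt \<omega>) u w \<and> rls (F \<omega>) (lt \<omega>) w v}"
    using assms
  proof
    assume "AE \<omega> in M. unique_succession_line (F \<omega>) (lt \<omega>)"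
    then show ?thesis using AE_space
    proof eventually_elim
      case (elim \<omega>)
      then show ?case using eft.finite_interval_unique_line[OF eft] by blast
    qed
  next
    assume "AE \<omega> in M. class_II (F \<omega>)"
    from AE_no_deep[OF this] AE_space show ?thesis
    proof eventually_elim
      case (elim \<omega>)
      then show ?case using eft.finite_interval[OF eft] by blast
    qed
  qed
  then show ?thesis using AE_no_minimum AE_space
  proof eventually_elim
    case (elim \<omega>)
    then show ?case using eft.int_like_def[OF eft] by blast
  qed
qed

end

subsection \<open>Measurability of the record graph code\<close>

lemma measurable_binary_count:
  fixes f :: "'a \<Rightarrow> 'b :: countable"
  assumes "f \<in> measurable M (count_space UNIV)" "g \<in> measurable M (count_space UNIV)"
  shows "(\<lambda>x. h (f x) (g x)) \<in> measurable M (count_space UNIV)"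
  by (rule measurable_compose_countable[OF measurable_compose[OF assms(2)] assms(1)]) simp

lemma measurable_card_countable:
  fixes S :: "'a \<Rightarrow> 'b :: countable set"
  assumes [measurable]: "\<And>u. Measurable.pred M (\<lambda>x. u \<in> S x)"
  shows "(\<lambda>x. card (S x)) \<in> measurable M (count_space UNIV)"
proof -
  have "card (to_nat ` S x) = card (S x)" for x by (simp add: card_image)
  moreover have "(\<lambda>x. card (to_nat ` S x)) \<in> measurable M (count_space UNIV)"
  proof (rule measurable_card)
    fix i
    have "{x\<in>space M. i \<in> to_nat ` S x} = {x\<in>space M. \<exists>u. i = to_nat u \<and> u \<in> S x}" by auto
    also have "\<dots> \<in> sets M" by measurable
    finally show "{x\<in>space M. i \<in> to_nat ` S x} \<in> sets M" .
  qed
  ultimately show ?thesis by simp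
qed

text \<open>Finiteness is boundedness after encoding by \<open>to_nat\<close>, a countable
  combination of membership events.\<close>

lemma pred_finite_countable:
  fixes S :: "'a \<Rightarrow> 'b :: countable set"
  assumes [measurable]: "\<And>u. Measurable.pred M (\<lambda>x. u \<in> S x)"
  shows "Measurable.pred M (\<lambda>x. finite (S x))"
proof -
  have "finite (S x) \<longleftrightarrow> (\<exists>n. \<forall>u. u \<in> S x \<longrightarrow> to_nat u < n)" for x
  proof -
    have "finite (S x) \<longleftrightarrow> finite (to_nat ` S x)"
      by (rule finite_image_iff[symmetric]) (simp add: inj_on_subset[OF inj_to_nat])
    then show ?thesis unfolding finite_nat_set_iff_bounded by auto
  qed
  then show ?thesis by simp
qed

lemma measurable_option_count:
  fixes f :: "'a \<Rightarrow> 'b :: countable option"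
  assumes [measurable]: "\<And>u. Measurable.pred M (\<lambda>x. f x = Some u)"
  shows "f \<in> measurable M (count_space UNIV)"
  unfolding measurable_count_space_eq2_countable
proof (intro conjI ballI)
  fix a
  have "f -` {a} \<inter> space M = {x\<in>space M. case a of Some u \<Rightarrow> f x = Some u | None \<Rightarrow> (\<forall>u. f x \<noteq> Some u)}"
    by (auto split: option.splits)
  also have "\<dots> \<in> sets M"
  proof (cases a)
    case None
    then show ?thesis unfolding None option.case by measurable
  next
    case (Some u)
    then show ?thesis unfolding Some option.case by measurable
  qed
  finally show "f -` {a} \<inter> space M \<in> sets M" .
qed simp

lemma measurable_bind_count:
  fixes f :: "'a \<Rightarrow> 'b :: countable option"
  assumes "f \<in> measurable M (count_space UNIV)" "\<And>u. g u \<in> measurable M (count_space UNIV)"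
  shows "(\<lambda>x. Option.bind (f x) (\<lambda>u. g u x)) \<in> measurable M (count_space UNIV)"
proof (rule measurable_compose_countable[OF _ assms(1), of "\<lambda>a x. Option.bind a (\<lambda>u. g u x)"])
  show "(\<lambda>x. Option.bind a (\<lambda>u. g u x)) \<in> measurable M (count_space UNIV)" for a
    using assms(2) by (cases a) simp_all
qed

section \<open>Record times, components and children as measurable functions\<close>

lemma measurable_seq_component [measurable]: "(\<lambda>y. y n) \<in> measurable seq_space (count_space UNIV)"
  unfolding seq_space_def by measurable

lemma measurable_seq_sum:
  "finite A \<Longrightarrow> (\<lambda>y. \<Sum>l\<in>A. y l) \<in> measurable seq_space (count_space (UNIV :: int set))"
proof (induction A rule: finite_induct)
  case (insert a A)
  then show ?case
    using measurable_binary_count[OF measurable_seq_component[of a] insert.IH, of "(+)"] by simp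
qed simp

text \<open>Writing candidate times as \<open>i + 1 + int k\<close> replaces the infimum over
  integers by a least natural number, which is measurable by
  \<open>measurable_Least\<close>.\<close>

lemma rec_R_Least:
  defines "P \<equiv> \<lambda>y i k. 0 \<le> (\<Sum>l\<in>{i..<i + 1 + int k}. y l)"
  shows "rec_R y i = (if \<exists>k. P y i k then i + 1 + int (LEAST k. P y i k) else i)"
proof (cases "\<exists>k. P y i k")
  case True
  define m where "m = (LEAST k. P y i k)"
  have "P y i m" unfolding m_def using True by (rule LeastI_ex)
  have "rec_R y i = i + 1 + int m"
  proof (rule rec_R_eqI)
    show "0 \<le> (\<Sum>l\<in>{i..<i + 1 + int m}. y l)" using \<open>P y i m\<close> by (simp only: P_def)
    fix n assume n: "i < n" "n < i + 1 + int m"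
    then have "nat (n - i - 1) < m" by linarith
    then have "\<not> P y i (nat (n - i - 1))" unfolding m_def by (rule not_less_Least)
    then show "(\<Sum>l\<in>{i..<n}. y l) < 0" using n(1) by (simp add: P_def)
  qed simp
  then show ?thesis using True by (simp only: m_def if_True)
next
  case False
  have "\<not> (\<Sum>l\<in>{i..<n}. y l) \<ge> 0" if "n > i" for n
    using False[unfolded not_ex, rule_format, of "nat (n - i - 1)"] that by (simp add: P_def)
  then have "rec_R y i = i" unfolding rec_R_def by auto
  then show ?thesis using False by simp
qed

lemma measurable_rec_R [measurable]: "(\<lambda>y. rec_R y i) \<in> measurable seq_space (count_space UNIV)"
proof -
  have [measurable]: "Measurable.pred seq_space (\<lambda>y. 0 \<le> (\<Sum>l\<in>{i..<i + 1 + int k}. y l))" for k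
    by (rule measurable_compose[OF measurable_seq_sum]) simp_all
  have "(\<lambda>y. i + 1 + int (LEAST k. 0 \<le> (\<Sum>l\<in>{i..<i + 1 + int k}. y l))) \<in> measurable seq_space (count_space UNIV)"
    by (rule measurable_compose[OF measurable_Least]) simp_all
  then show ?thesis unfolding rec_R_Least by (intro measurable_If) auto
qed

lemma measurable_record_par [measurable]: "(\<lambda>y. record_par y i) \<in> measurable seq_space (count_space UNIV)"
  unfolding record_par_def by (rule measurable_compose[OF measurable_rec_R]) simp

text \<open>Reachability is a countable union over path lengths and intermediate vertices.\<close>

lemma pred_record_comp [measurable]: "Measurable.pred seq_space (\<lambda>y. j \<in> record_comp y)"
proof -
  have [measurable]: "Measurable.pred seq_space (\<lambda>y. record_edge y a b)" for a b
    unfolding record_edge_def by (rule measurable_compose[OF measurable_rec_R]) simp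
  have [measurable]: "Measurable.pred seq_space (\<lambda>y. ((\<lambda>a b. record_edge y a b \<or> record_edge y b a) ^^ n) 0 j)" for n j
  proof (induction n arbitrary: j)
    case (Suc n)
    note [measurable] = Suc
    show ?case unfolding relpowp.simps OO_def by measurable
  qed simp
  show ?thesis unfolding record_comp_def mem_Collect_eq rtranclp_power by measurable
qed

lemma pred_record_children [measurable]:
  "Measurable.pred seq_space (\<lambda>y. u \<in> children (record_comp y) (record_par y) v)"
  unfolding children_def mem_Collect_eq by measurable

lemma measurable_record_child_idx [measurable]:
  "(\<lambda>y. child_idx (record_comp y) (record_par y) (<) u) \<in> measurable seq_space (count_space UNIV)"
  unfolding child_idx_def
proof (rule measurable_card_countable)
  fix u'
  have [measurable]: "Measurable.pred seq_space (\<lambda>y. record_par y u' = record_par y u)"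
    by (rule measurable_binary_count[OF measurable_record_par measurable_record_par])
  show "Measurable.pred seq_space
      (\<lambda>y. u' \<in> {u' \<in> record_comp y. record_par y u' = record_par y u \<and> u' < u})"
    unfolding mem_Collect_eq by measurable
qed

text \<open>Removes the definite description. Finiteness matters: with infinitely many earlier
  siblings \<open>card\<close> is 0 by convention, and indices would no longer separate
  children.\<close>

lemma nth_child_linorder:
  fixes v :: "'a :: linorder"
  shows "nth_child V par (<) v i = Some u \<longleftrightarrow>
    finite (children V par v) \<and> u \<in> children V par v \<and> child_idx V par (<) u = i"
proof -
  have less: "child_idx V par (<) u < child_idx V par (<) w"
    if "finite (children V par v)" "u \<in> children V par v" "w \<in> children V par v" "u < w" for u w
    unfolding child_idx_def
  proof (rule psubset_card_mono)
    show "finite {u' \<in> V. par u' = par w \<and> u' < w}"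
      by (rule finite_subset[OF _ that(1)]) (use that in \<open>auto simp: children_def\<close>)
    show "{u' \<in> V. par u' = par u \<and> u' < u} \<subset> {u' \<in> V. par u' = par w \<and> u' < w}"
      using that unfolding children_def by auto
  qed
  have "(THE w. w \<in> children V par v \<and> child_idx V par (<) w = i) = u"
    if "finite (children V par v)" "u \<in> children V par v" "child_idx V par (<) u = i" for u
    using that less by (intro the_equality) (auto, metis less_irrefl linorder_cases)
  then show ?thesis unfolding nth_child_def by auto
qed

lemma measurable_record_nth_child [measurable]:
  "(\<lambda>y. nth_child (record_comp y) (record_par y) (<) v i) \<in> measurable seq_space (count_space UNIV)"
proof (rule measurable_option_count)
  have [measurable]: "Measurable.pred seq_space (\<lambda>y. finite (children (record_comp y) (record_par y) v))"
    by (rule pred_finite_countable) measurable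
  show "Measurable.pred seq_space (\<lambda>y. nth_child (record_comp y) (record_par y) (<) v i = Some u)" for u
    unfolding nth_child_linorder by measurable
qed

lemma measurable_record_desc:
  "(\<lambda>y. desc (record_comp y) (record_par y) (<) v w) \<in> measurable seq_space (count_space UNIV)"
proof (induction w arbitrary: v)
  case (Cons i w)
  show ?case unfolding desc.simps
    by (rule measurable_bind_count[OF measurable_record_nth_child Cons])
qed simp

lemma measurable_record_anc: "(\<lambda>y. anc (record_par y) k v) \<in> measurable seq_space (count_space UNIV)"
proof (induction k)
  case (Suc k)
  have "(\<lambda>y. Option.bind (anc (record_par y) k v) (record_par y)) \<in> measurable seq_space (count_space UNIV)"
    by (rule measurable_bind_count[OF Suc, of "\<lambda>u y. record_par y u"]) measurable
  then show ?case by (simp add: anc_def)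
qed (simp add: anc_def)

lemma measurable_record_addr:
  "(\<lambda>y. addr (record_comp y) (record_par y) (<) v a) \<in> measurable seq_space (count_space UNIV)"
  unfolding addr_def by (rule measurable_bind_count[OF measurable_record_anc measurable_record_desc])

lemma measurable_record_code: "record_code \<in> measurable seq_space code_space"
proof -
  \<comment> \<open>Separates the two ancestors, which take countably many values, from the
    remaining dependence on \<open>y\<close>, so that they can be fixed one at a time.\<close>
  define f where "f a b y = (case (a :: int option, b :: int option) of
      (Some a, Some _) \<Rightarrow> Some (child_idx (record_comp y) (record_par y) (<) a) | _ \<Rightarrow> None)" for a b y
  have 1: "(\<lambda>y. f (anc (record_par y) k 0) (anc (record_par y) (Suc k) 0) y) \<in> measurable seq_space (count_space UNIV)" for k
  proof -
    have "f a b \<in> measurable seq_space (count_space UNIV)" for a b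
      unfolding f_def by (cases a; cases b) (auto intro: measurable_compose[OF measurable_record_child_idx])
    then have "(\<lambda>y. f a (anc (record_par y) (Suc k) 0) y) \<in> measurable seq_space (count_space UNIV)" for a
      by (rule measurable_compose_countable[OF _ measurable_record_anc])
    then show ?thesis by (rule measurable_compose_countable[OF _ measurable_record_anc])
  qed
  have 2: "(\<lambda>y. map_option (\<lambda>v. if finite (children (record_comp y) (record_par y) v)
        then enat (card (children (record_comp y) (record_par y) v)) else \<infinity>)
        (addr (record_comp y) (record_par y) (<) 0 a)) \<in> measurable seq_space (count_space UNIV)" for a
  proof (rule measurable_compose_countable[OF _ measurable_record_addr])
    fix b :: "int option"
    have "(\<lambda>y. if finite (children (record_comp y) (record_par y) v)
        then enat (card (children (record_comp y) (record_par y) v)) else \<infinity>) \<in> measurable seq_space (count_space UNIV)" for v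
    proof (rule measurable_If)
      show "(\<lambda>y. enat (card (children (record_comp y) (record_par y) v))) \<in> measurable seq_space (count_space UNIV)"
        by (rule measurable_compose[OF measurable_card_countable]) simp_all
      show "{y \<in> space seq_space. finite (children (record_comp y) (record_par y) v)} \<in> sets seq_space"
        unfolding pred_def[symmetric] by (rule pred_finite_countable) measurable
    qed simp
    then show "(\<lambda>y. map_option (\<lambda>v. if finite (children (record_comp y) (record_par y) v)
        then enat (card (children (record_comp y) (record_par y) v)) else \<infinity>) b) \<in> measurable seq_space (count_space UNIV)"
      by (cases b) (auto intro: measurable_compose)
  qed
  show ?thesis
    unfolding record_code_def tree_code_def code_space_def f_def[symmetric]
    by (intro measurable_Pair measurable_PiM_single') (use 1 2 in auto)
qed

subsection \<open>Stationarity\<close>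

text \<open>A vertex sends its unit of mass only if its own sequence lies in \<open>A\<close>. The
  root then sends the indicator for its sequence and receives, from its successor, the indicator for
  the shifted sequence.\<close>

lemma (in unimodular_tree) code_seq_stationary:
  assumes il: "AE \<omega> in M. eft.int_like (F \<omega>) (lt \<omega>)" and A: "A \<in> sets seq_space"
  shows "emeasure M {\<omega>\<in>space M. code_seq (code_at \<omega> (r \<omega>)) \<in> A} =
    emeasure M {\<omega>\<in>space M. (\<lambda>n. code_seq (code_at \<omega> (r \<omega>)) (n + 1)) \<in> A}"
proof -
  let ?y = "\<lambda>\<omega> x. code_seq (code_at \<omega> x)"
  let ?P = "\<lambda>\<omega> x u. ?y \<omega> x \<in> A \<and> is_a (F \<omega>) (lt \<omega>) u x"
  have seq: "(\<lambda>\<omega>. ?y \<omega> (r \<omega>)) \<in> measurable M seq_space"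
    by (rule measurable_compose[OF measurable_root_code measurable_code_seq])
  have shift: "(\<lambda>y n. y (n + 1)) \<in> measurable seq_space seq_space"
    unfolding seq_space_def by (rule measurable_PiM_single') auto
  have S0: "{\<omega>\<in>space M. ?y \<omega> (r \<omega>) \<in> A} \<in> sets M"
    by (rule measurable_sets_Collect[OF seq]) (use A in \<open>simp add: pred_def\<close>)
  have S1: "{\<omega>\<in>space M. (\<lambda>n. ?y \<omega> (r \<omega>) (n + 1)) \<in> A} \<in> sets M"
    by (rule measurable_sets_Collect[OF measurable_compose[OF seq shift]]) (use A in \<open>simp add: pred_def\<close>)
  have both: "AE \<omega> in M. (\<exists>u. {u. is_a (F \<omega>) (lt \<omega>) u (r \<omega>)} = {u}) \<and>
      (\<exists>u. {u. is_a (F \<omega>) (lt \<omega>) (r \<omega>) u} = {u} \<and> ?y \<omega> u = (\<lambda>n. ?y \<omega> (r \<omega>) (n + 1)))"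
    using il AE_space
  proof eventually_elim
    case (elim \<omega>)
    interpret eft "F \<omega>" "lt \<omega>" using elim(2) by (rule eft)
    obtain \<phi> :: "int \<Rightarrow> nat" where \<phi>: "\<phi> 0 = r \<omega>" "bij \<phi>" "\<And>i j. rls (F \<omega>) (lt \<omega>) (\<phi> i) (\<phi> j) \<longleftrightarrow> i < j"
      by (rule int_like_enum[OF elim(1), of "r \<omega>"]) blast
    have surj: "\<exists>i. u = \<phi> i" for u using \<phi>(2) by (metis bij_pointE)
    note is_a = is_a_enum[OF \<phi>(2,3)]
    have "{u. is_a (F \<omega>) (lt \<omega>) u (r \<omega>)} = {\<phi> (-1)}"
    proof (intro set_eqI)
      fix u
      obtain i where "u = \<phi> i" using surj by blast
      then show "u \<in> {u. is_a (F \<omega>) (lt \<omega>) u (r \<omega>)} \<longleftrightarrow> u \<in> {\<phi> (-1)}"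
        using is_a[of i 0] \<phi>(1) bij_is_inj[OF \<phi>(2)] by (auto simp: inj_eq)
    qed
    moreover have "{u. is_a (F \<omega>) (lt \<omega>) (r \<omega>) u} = {\<phi> 1}"
    proof (intro set_eqI)
      fix u
      obtain i where "u = \<phi> i" using surj by blast
      then show "u \<in> {u. is_a (F \<omega>) (lt \<omega>) (r \<omega>) u} \<longleftrightarrow> u \<in> {\<phi> 1}"
        using is_a[of 0 i] \<phi>(1) bij_is_inj[OF \<phi>(2)] by (auto simp: inj_eq)
    qed
    moreover have "?y \<omega> (\<phi> 1) = (\<lambda>n. ?y \<omega> (r \<omega>) (n + 1))"
    proof
      fix n
      have "1 + n + 1 = 0 + (n + 1) + (1 :: int)" by simp
      then show "?y \<omega> (\<phi> 1) n = ?y \<omega> (r \<omega>) (n + 1)"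
        unfolding \<phi>(1)[symmetric] code_seq_enum[OF \<phi>(2,3)] by (simp only:)
    qed
    ultimately show ?case by blast
  qed
  have "emeasure M {\<omega>\<in>space M. ?y \<omega> (r \<omega>) \<in> A} =
      (\<integral>\<^sup>+ \<omega>. indicator {\<omega>\<in>space M. ?y \<omega> (r \<omega>) \<in> A} \<omega> \<partial>M)"
    by (rule nn_integral_indicator[OF S0, symmetric])
  also have "\<dots> = (\<integral>\<^sup>+ \<omega>. emeasure (count_space UNIV) {u. ?P \<omega> (r \<omega>) u} \<partial>M)"
  proof (rule nn_integral_cong_AE, use both AE_space in eventually_elim)
    case (elim \<omega>)
    then obtain u where "{u. is_a (F \<omega>) (lt \<omega>) u (r \<omega>)} = {u}" by blast
    then show ?case using elim(2) by (cases "?y \<omega> (r \<omega>) \<in> A") simp_all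
  qed
  also have "\<dots> = (\<integral>\<^sup>+ \<omega>. emeasure (count_space UNIV) {u. ?P \<omega> u (r \<omega>)} \<partial>M)"
  proof (rule mass_transport[of "\<lambda>c a. code_seq c \<in> A \<and> code_succ c a (0, [])"])
    show "Measurable.pred code_space (\<lambda>c. code_seq c \<in> A \<and> code_succ c a (0, []))" for a
    proof (rule pred_intros_logic(3))
      show "Measurable.pred code_space (\<lambda>c. code_seq c \<in> A)"
        by (rule measurable_compose[OF measurable_code_seq]) (use A in \<open>simp add: pred_def\<close>)
    qed measurable
    fix \<omega> x u assume w: "\<omega> \<in> space M"
    interpret eft "F \<omega>" "lt \<omega>" using w by (rule eft)
    show "(?y \<omega> x \<in> A \<and> code_succ (code_at \<omega> x) (rel_at \<omega> x u) (0, [])) \<longleftrightarrow> ?P \<omega> x u"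
      unfolding rel_self[of x, symmetric] code_succ_rel ..
  qed
  also have "\<dots> = (\<integral>\<^sup>+ \<omega>. indicator {\<omega>\<in>space M. (\<lambda>n. ?y \<omega> (r \<omega>) (n + 1)) \<in> A} \<omega> \<partial>M)"
  proof (rule nn_integral_cong_AE, use both AE_space in eventually_elim)
    case (elim \<omega>)
    then obtain u where u: "{u. is_a (F \<omega>) (lt \<omega>) (r \<omega>) u} = {u}"
      "?y \<omega> u = (\<lambda>n. ?y \<omega> (r \<omega>) (n + 1))" by blast
    have "{u. ?P \<omega> u (r \<omega>)} = {v \<in> {u. is_a (F \<omega>) (lt \<omega>) (r \<omega>) u}. ?y \<omega> v \<in> A}" by blast
    also have "\<dots> = (if (\<lambda>n. ?y \<omega> (r \<omega>) (n + 1)) \<in> A then {u} else {})"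
      unfolding u(1) u(2)[symmetric] by auto
    finally show ?case using elim(2) by simp
  qed
  also have "\<dots> = emeasure M {\<omega>\<in>space M. (\<lambda>n. ?y \<omega> (r \<omega>) (n + 1)) \<in> A}"
    by (rule nn_integral_indicator[OF S1])
  finally show ?thesis .
qed

theorem theorem5p1:
  fixes M :: "'w measure" and F :: "'w \<Rightarrow> nat \<Rightarrow> nat"
    and lt :: "'w \<Rightarrow> nat \<Rightarrow> nat \<Rightarrow> bool" and r :: "'w \<Rightarrow> nat"
  assumes "prob_space M"
    and "\<forall>\<omega>\<in>space M. ordered_EFT (F \<omega>) (lt \<omega>)"
    and "(\<lambda>\<omega>. tree_code UNIV (Some \<circ> F \<omega>) (lt \<omega>) (r \<omega>)) \<in> measurable M code_space"
    and "unimodular_EFT M F lt r"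
    and "(AE \<omega> in M. unique_succession_line (F \<omega>) (lt \<omega>)) \<or> (AE \<omega> in M. class_II (F \<omega>))"
  shows "\<exists>N. prob_space N \<and> sets N = sets seq_space \<and>
           (AE y in N. \<forall>n. y n \<ge> -1) \<and>
           distr N seq_space (\<lambda>y n. y (n + 1)) = N \<and>
           distr N code_space record_code
             = distr M code_space (\<lambda>\<omega>. tree_code UNIV (Some \<circ> F \<omega>) (lt \<omega>) (r \<omega>))"
proof -
  interpret unimodular_tree M F lt r
    by (intro unimodular_tree.intro unimodular_tree_axioms.intro) (use assms in auto)
  define Y where "Y \<omega> = code_seq (code_at \<omega> (r \<omega>))" for \<omega>
  note il = AE_int_like[OF assms(5)]
  have Y: "Y \<in> measurable M seq_space"
    unfolding Y_def by (rule measurable_compose[OF measurable_root_code measurable_code_seq])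
  have shift: "(\<lambda>y n. y (n + 1)) \<in> measurable seq_space seq_space"
    unfolding seq_space_def by (rule measurable_PiM_single') auto
  \<comment> \<open>Valid at every sample point: \<open>code_seq\<close> is a natural number minus
    one even where the code has no succession line of integer type.\<close>
  have Y_ge: "Y \<omega> n \<ge> -1" for \<omega> n by (simp add: Y_def code_seq_def)
  have code: "AE \<omega> in M. record_code (Y \<omega>) = code_at \<omega> (r \<omega>)"
    using il AE_space
  proof eventually_elim
    case (elim \<omega>)
    interpret eft "F \<omega>" "lt \<omega>" using elim(2) by (rule eft)
    obtain \<phi> :: "int \<Rightarrow> nat" where \<phi>: "\<phi> 0 = r \<omega>" "bij \<phi>" "\<And>i j. rls (F \<omega>) (lt \<omega>) (\<phi> i) (\<phi> j) \<longleftrightarrow> i < j"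
      by (rule int_like_enum[OF elim(1), of "r \<omega>"]) blast
    have "Y \<omega> = (\<lambda>n. int (card {u. F \<omega> u = \<phi> (n + 1)}) - 1)"
      using code_seq_enum[OF \<phi>(2,3), of 0] \<phi>(1) by (auto simp: Y_def)
    then show ?case using record_code_enum[OF \<phi>(2,3)] \<phi>(1) by simp
  qed
  define N where "N = distr M seq_space Y"
  show ?thesis
  proof (intro exI[of _ N] conjI)
    show "prob_space N" unfolding N_def by (rule prob_space_distr[OF Y])
    show "sets N = sets seq_space" by (simp add: N_def)
    show "AE y in N. \<forall>n. y n \<ge> -1"
      unfolding N_def
    proof (subst AE_distr_iff[OF Y])
      have [measurable]: "Measurable.pred seq_space (\<lambda>y. y n \<ge> -1)" for n
        by (rule measurable_compose[OF measurable_seq_component]) simp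
      show "{y \<in> space seq_space. \<forall>n. y n \<ge> -1} \<in> sets seq_space" by measurable
    qed (simp add: Y_ge)
    show "distr N seq_space (\<lambda>y n. y (n + 1)) = N"
      unfolding N_def distr_distr[OF shift Y]
    proof (rule measure_eqI)
      fix A assume "A \<in> sets (distr M seq_space ((\<lambda>y n. y (n + 1)) \<circ> Y))"
      then have A: "A \<in> sets seq_space" by simp
      have "emeasure (distr M seq_space ((\<lambda>y n. y (n + 1)) \<circ> Y)) A =
          emeasure M {\<omega>\<in>space M. (\<lambda>n. Y \<omega> (n + 1)) \<in> A}"
        by (subst emeasure_distr[OF measurable_comp[OF Y shift] A])
           (auto intro!: arg_cong[of _ _ "emeasure M"])
      also have "\<dots> = emeasure M {\<omega>\<in>space M. Y \<omega> \<in> A}"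
        unfolding Y_def by (rule code_seq_stationary[OF il A, symmetric])
      also have "\<dots> = emeasure (distr M seq_space Y) A"
        by (subst emeasure_distr[OF Y A]) (auto intro!: arg_cong[of _ _ "emeasure M"])
      finally show "emeasure (distr M seq_space ((\<lambda>y n. y (n + 1)) \<circ> Y)) A = emeasure (distr M seq_space Y) A" .
    qed simp
    have "distr N code_space record_code = distr M code_space (record_code \<circ> Y)"
      unfolding N_def by (rule distr_distr[OF measurable_record_code Y])
    also have "\<dots> = distr M code_space (\<lambda>\<omega>. code_at \<omega> (r \<omega>))"
      by (rule distr_cong_AE)
         (use code measurable_comp[OF Y measurable_record_code] measurable_root_code in \<open>auto simp: o_def\<close>)
    finally show "distr N code_space record_code = distr M code_space (\<lambda>\<omega>. code_at \<omega> (r \<omega>))" .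
  qed
qed

end
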